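(* Let $H:\mathbb{R}^d\times\mathbb{R}^d\to\mathbb{R}$ be a smooth Hamiltonian and, for $\lambda\in\mathbb{R}$, let $\Phi_h^\lambda:(p_n,q_n)\mapsto(p_{n+1},q_{n+1})$ be the one-step method defined by $$p_{n+1}=p_n-hH_q\big(\lambda p_{n+1}+(1-\lambda)p_n,\ \lambda q_n+(1-\lambda)q_{n+1}\big),\qquad q_{n+1}=q_n+hH_p\big(\lambda p_{n+1}+(1-\lambda)p_n,\ \lambda q_n+(1-\lambda)q_{n+1}\big).$$ Then for every $\lambda\in\mathbb{R}$ the adjoint method of $\Phi_h^\lambda$ is $(\Phi_h^\lambda)^*=\Phi_h^{1-\lambda}$, and the composition $$\Psi_h^\lambda=\Phi_{h/2}^\lambda\circ(\Phi_{h/2}^\lambda)^*=\Phi_{h/2}^\lambda\circ\Phi_{h/2}^{1-\lambda}$$ is a symmetric symplectic scheme of order $2$ for the Hamiltonian system $\dot p=-H_q(p,q)$, $\dot q=H_p(p,q)$.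
   Context: $H_p,H_q$ denote the column vectors of partial derivatives of $H=H(p,q)$ with respect to its first and second argument. The step size $h$ (of either sign) is small enough that the implicit equations locally define smooth maps close to the identity. The adjoint of a one-step method $\Phi_h$ is $\Phi_h^*=(\Phi_{-h})^{-1}$, and a method is symmetric if $\Phi_h^*=\Phi_h$. A one-step method is symplectic if its Jacobian $M=\partial(p_{n+1},q_{n+1})/\partial(p_n,q_n)$ satisfies $M^TJM=J$ with $J=\begin{pmatrix}0&I_d\\-I_d&0\end{pmatrix}$. It is of order $2$ if its local error, i.e. the difference after one step of size $h$ between the numerical and the exact solution starting from the same point, is $\mathcal{O}(h^{3})$ as $h\to0$. *)

theory Defs
  imports "HOL-Analysis.Analysis" "HOL-Library.Landau_Symbols"
begin

type_synonym 'd phase = "(real ^ 'd) \<times> (real ^ 'd)"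

primrec k_times_differentiable ::
  "nat \<Rightarrow> ('a::real_normed_vector \<Rightarrow> 'b::real_normed_vector) \<Rightarrow> bool" where
  "k_times_differentiable 0 f \<longleftrightarrow> continuous_on UNIV f"
| "k_times_differentiable (Suc k) f \<longleftrightarrow>
     (\<forall>x. f differentiable at x) \<and>
     (\<forall>v. k_times_differentiable k (\<lambda>x. frechet_derivative f (at x) v))"

text \<open>The zeroth level asks for continuity, so on a finite-dimensional domain level \<open>k\<close> is
  the class \<open>C\<^sup>k\<close>, and \<open>smooth\<close> is \<open>C\<^sup>\<infinity>\<close>.\<close>
definition smooth :: "('a::real_normed_vector \<Rightarrow> 'b::real_normed_vector) \<Rightarrow> bool" where
  "smooth f \<longleftrightarrow> (\<forall>k. k_times_differentiable k f)"

definition H_p :: "('d::finite phase \<Rightarrow> real) \<Rightarrow> 'd phase \<Rightarrow> real ^ 'd" where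
  "H_p H z = (\<chi> i. deriv (\<lambda>t. H (fst z + t *\<^sub>R axis i 1, snd z)) 0)"

definition H_q :: "('d::finite phase \<Rightarrow> real) \<Rightarrow> 'd phase \<Rightarrow> real ^ 'd" where
  "H_q H z = (\<chi> i. deriv (\<lambda>t. H (fst z, snd z + t *\<^sub>R axis i 1)) 0)"

definition implicit_step ::
  "('d::finite phase \<Rightarrow> real) \<Rightarrow> real \<Rightarrow> real \<Rightarrow> 'd phase \<Rightarrow> 'd phase \<Rightarrow> bool" where
  "implicit_step H lam h z z' \<longleftrightarrow>
     (case (z, z') of ((p, q), (p', q')) \<Rightarrow>
        p' = p - h *\<^sub>R H_q H (lam *\<^sub>R p' + (1 - lam) *\<^sub>R p, lam *\<^sub>R q + (1 - lam) *\<^sub>R q') \<and>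
        q' = q + h *\<^sub>R H_p H (lam *\<^sub>R p' + (1 - lam) *\<^sub>R p, lam *\<^sub>R q + (1 - lam) *\<^sub>R q'))"

text \<open>The implicit equations may have spurious solutions far away; the numerical method is the
  solution branch close to the identity, here the solution nearest to the starting point. The
  value is arbitrary when \<open>h\<close> is so large that no solution, or no unique nearest one, exists.\<close>
definition Phi ::
  "('d::finite phase \<Rightarrow> real) \<Rightarrow> real \<Rightarrow> real \<Rightarrow> 'd phase \<Rightarrow> 'd phase" where
  "Phi H lam h z = (ARG_MIN (dist z) z'. implicit_step H lam h z z')"

definition Psi ::
  "('d::finite phase \<Rightarrow> real) \<Rightarrow> real \<Rightarrow> real \<Rightarrow> 'd phase \<Rightarrow> 'd phase" where
  "Psi H lam h = Phi H lam (h / 2) \<circ> Phi H (1 - lam) (h / 2)"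

text \<open>A one-step method is a family of maps indexed by the step size. As it is meaningful only
  locally and for small steps, every assertion about it below is made near each point \<open>z0\<close>
  for all sufficiently small \<open>h\<close> of either sign.\<close>

definition locally_equal ::
  "(real \<Rightarrow> 'a::topological_space \<Rightarrow> 'b) \<Rightarrow> (real \<Rightarrow> 'a \<Rightarrow> 'b) \<Rightarrow> bool" where
  "locally_equal F G \<longleftrightarrow> (\<forall>z0. \<forall>\<^sub>F (h, z) in nhds (0, z0). F h z = G h z)"

definition locally_defined_by ::
  "(real \<Rightarrow> 'a::metric_space \<Rightarrow> 'a) \<Rightarrow> (real \<Rightarrow> 'a \<Rightarrow> 'a \<Rightarrow> bool) \<Rightarrow> bool" where
  "locally_defined_by F R \<longleftrightarrow>
     (\<forall>z0. ((\<lambda>(h, z). F h z) \<longlongrightarrow> z0) (nhds (0, z0)) \<and>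
       (\<exists>\<delta>>0. \<forall>\<^sub>F (h, z) in nhds (0, z0).
          F h z \<in> ball z0 \<delta> \<and> (\<forall>z'\<in>ball z0 \<delta>. R h z z' \<longleftrightarrow> z' = F h z)))"

text \<open>\<open>is_adjoint F G\<close>: locally, \<open>G h\<close> is the inverse map of \<open>F (- h)\<close>.\<close>
definition is_adjoint ::
  "(real \<Rightarrow> 'a::topological_space \<Rightarrow> 'a) \<Rightarrow> (real \<Rightarrow> 'a \<Rightarrow> 'a) \<Rightarrow> bool" where
  "is_adjoint F G \<longleftrightarrow>
     (\<forall>z0. \<exists>U V h0. open U \<and> z0 \<in> U \<and> open V \<and> z0 \<in> V \<and> h0 > 0 \<and>
       (\<forall>h. \<bar>h\<bar> < h0 \<longrightarrow>
          inj_on (F (- h)) U \<and> V \<subseteq> F (- h) ` U \<and>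
          (\<forall>w\<in>V. G h w = inv_into U (F (- h)) w)))"

definition symmetric_method :: "(real \<Rightarrow> 'a::topological_space \<Rightarrow> 'a) \<Rightarrow> bool" where
  "symmetric_method F \<longleftrightarrow> is_adjoint F F"

definition stack :: "'d::finite phase \<Rightarrow> real ^ ('d + 'd)" where
  "stack z = (\<chi> k. case k of Inl i \<Rightarrow> fst z $ i | Inr i \<Rightarrow> snd z $ i)"

definition unstack :: "real ^ ('d + 'd) \<Rightarrow> 'd::finite phase" where
  "unstack x = ((\<chi> i. x $ Inl i), (\<chi> i. x $ Inr i))"

definition J_mat :: "real ^ ('d::finite + 'd) ^ ('d + 'd)" where
  "J_mat = (\<chi> k l. case (k, l) of
      (Inl i, Inr j) \<Rightarrow> if i = j then 1 else 0
    | (Inr i, Inl j) \<Rightarrow> if i = j then - 1 else 0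
    | _ \<Rightarrow> 0)"

definition symplectic_at :: "('d::finite phase \<Rightarrow> 'd phase) \<Rightarrow> 'd phase \<Rightarrow> bool" where
  "symplectic_at f z \<longleftrightarrow>
     f differentiable at z \<and>
     (let M = jacobian (stack \<circ> f \<circ> unstack) (at (stack z))
      in transpose M ** J_mat ** M = J_mat)"

definition symplectic_method :: "(real \<Rightarrow> 'd::finite phase \<Rightarrow> 'd phase) \<Rightarrow> bool" where
  "symplectic_method F \<longleftrightarrow> (\<forall>z0. \<forall>\<^sub>F (h, z) in nhds (0, z0). symplectic_at (F h) z)"

definition hamiltonian_field :: "('d::finite phase \<Rightarrow> real) \<Rightarrow> 'd phase \<Rightarrow> 'd phase" where
  "hamiltonian_field H z = (- H_q H z, H_p H z)"

text \<open>\<open>y\<close> ranges over the solutions of \<open>y' = f y\<close> through \<open>z0\<close> on arbitrarily short intervals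
  around 0.\<close>
definition method_of_order ::
  "nat \<Rightarrow> (real \<Rightarrow> 'a::real_normed_vector \<Rightarrow> 'a) \<Rightarrow> ('a \<Rightarrow> 'a) \<Rightarrow> bool" where
  "method_of_order r F f \<longleftrightarrow>
     (\<forall>z0 y T. T > 0 \<longrightarrow> y 0 = z0 \<longrightarrow>
        (\<forall>t\<in>{-T<..<T}. (y has_vector_derivative f (y t)) (at t)) \<longrightarrow>
        (\<lambda>h. norm (F h z0 - y h)) \<in> O[at 0](\<lambda>h. h ^ (r + 1)))"

end

(*
  Writing X for the Hamiltonian field and D(p,q) = (lam p, (1-lam) q), the method is
  z' = z + h X(D z' + E z) with D + E = id, and exchanging z with z', h with -h exchanges D
  with E.  This gives the adjoint.  In terms of the stage value w = D z' + E z both ends are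
  explicit, z = w - h D X(w) and z' = w + h E X(w), so the Jacobian is B A^{-1} with
  A = I - h D K, B = I + h E K, K = X'(w).  As K is Hamiltonian, A and B pull the symplectic
  form back to the same form: the linear terms differ by h (K^T J + J K) = 0, and both
  quadratic terms are h^2 lam (1-lam) K^T J K.  So already the method itself is symplectic.
  For the order, the two half steps with k = h/2 add up to k (X(w1) + X(w2)), and expanding
  both stage values to first order gives h X + h^2/2 X' X + O(h^3).
*)
theory Submission
  imports Defs
begin

section \<open>Smooth vector fields\<close>

text \<open>\<open>Phi\<close> selects the nearest solution of an implicit equation among all
  solutions in the whole space, so before anything else this choice has to be localised. A
  contraction with factor 1/2 yields exactly one solution in a ball around \<open>z0\<close>,
  solutions outside the ball are farther from the starting point, and all constants are uniform in
  \<open>(h, z)\<close>. From then on the method is known through uniqueness in that ball; in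
  particular each inverse relation is a uniqueness statement. Differentiability of the step comes
  from the stage value: it is a continuous right inverse of the explicit map
  \<open>w - h D X(w)\<close>, whose derivative is invertible for small \<open>h\<close>, so the
  inverse function rule applies. That \<open>K\<close> is Hamiltonian rests on the symmetry of the
  Hessian, which is derived from iterated directional derivatives, the form in which smoothness is
  given. For the order, \<open>y\<close> is an arbitrary solution of the equation, so its Taylor
  expansion is obtained by integrating the equation repeatedly, starting from mere
  continuity.\<close>

lemma norm_le_basis_sum:
  fixes T :: "'a::euclidean_space \<Rightarrow> 'b::real_normed_vector"
  assumes "linear T"
  shows "norm (T u) \<le> (\<Sum>b\<in>Basis. norm (T b)) * norm u"
proof -
  have "T u = (\<Sum>b\<in>Basis. (u \<bullet> b) *\<^sub>R T b)"
    using assms by (subst euclidean_representation[of u, symmetric])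
      (simp only: linear_sum linear_cmul)
  also have "norm \<dots> \<le> (\<Sum>b\<in>Basis. norm (T b) * norm u)"
    by (rule sum_norm_le)
      (simp add: mult.commute[of "norm (T _)"] mult_right_mono Basis_le_norm)
  finally show ?thesis by (simp add: sum_distrib_right)
qed

text \<open>The second derivative is given direction by direction, the form in which
  \<open>k_times_differentiable\<close> delivers it. Summing over \<open>Basis\<close> with
  \<open>norm_le_basis_sum\<close> recovers operator norm bounds.\<close>

locale smooth_field =
  fixes X :: "'a::euclidean_space \<Rightarrow> 'a" and X' :: "'a \<Rightarrow> 'a \<Rightarrow> 'a"
  assumes X_deriv: "\<And>z. (X has_derivative X' z) (at z)"
    and X'_diff: "\<And>z u. (\<lambda>x. X' x u) differentiable (at z)"
begin

lemma linear_X': "linear (X' z)"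
  using X_deriv has_derivative_linear by blast

lemma continuous_on_X: "continuous_on S X"
  by (intro continuous_at_imp_continuous_on ballI has_derivative_continuous[OF X_deriv])

text \<open>Compactness of the closed unit ball: \<open>X\<close> and the sum of the norms of its
  partial derivatives are continuous there. Convexity of the ball then turns the derivative bound
  into a Lipschitz constant.\<close>

lemma X_bounds:
  obtains M L where "0 < M" "0 < L"
    "\<And>w. dist w z0 \<le> 1 \<Longrightarrow> norm (X w) \<le> M"
    "\<And>w u. dist w z0 \<le> 1 \<Longrightarrow> norm (X' w u) \<le> L * norm u"
    "\<And>v w. dist v z0 \<le> 1 \<Longrightarrow> dist w z0 \<le> 1 \<Longrightarrow> norm (X v - X w) \<le> L * norm (v - w)"
proof -
  have "compact (X ` cball z0 1)"
    by (intro compact_continuous_image continuous_on_X compact_cball)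
  then obtain M where M: "0 < M" "\<forall>y\<in>X ` cball z0 1. norm y \<le> M"
    using bounded_pos compact_imp_bounded by blast
  have "continuous_on (cball z0 1) (\<lambda>w. \<Sum>b\<in>Basis. norm (X' w b))"
    by (intro continuous_intros continuous_at_imp_continuous_on ballI
        differentiable_imp_continuous_within X'_diff)
  then have "compact ((\<lambda>w. \<Sum>b\<in>Basis. norm (X' w b)) ` cball z0 1)"
    by (intro compact_continuous_image compact_cball)
  then obtain L where L: "0 < L" "\<forall>y\<in>(\<lambda>w. \<Sum>b\<in>Basis. norm (X' w b)) ` cball z0 1. norm y \<le> L"
    using bounded_pos compact_imp_bounded by blast
  have X': "norm (X' w u) \<le> L * norm u" if "dist w z0 \<le> 1" for w u
  proof -
    have "(\<Sum>b\<in>Basis. norm (X' w b)) \<le> L"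
      using bspec[OF L(2) imageI[of w "cball z0 1"]] that by (simp add: dist_commute)
    then show ?thesis
      using norm_le_basis_sum[OF linear_X', of w u]
      by (meson mult_right_mono norm_ge_zero order_trans)
  qed
  have "norm (X v - X w) \<le> L * norm (v - w)" if "dist v z0 \<le> 1" "dist w z0 \<le> 1" for v w
  proof (rule differentiable_bound[of "cball z0 1" X X'])
    show "onorm (X' x) \<le> L" if "x \<in> cball z0 1" for x
      using that L(1) by (intro onorm_le X') (simp add: dist_commute)
  qed (use that X_deriv in \<open>auto simp: dist_commute intro: has_derivative_at_withinI\<close>)
  with M L X' show ?thesis
    by (intro that[of M L]) (auto simp: dist_commute)
qed

text \<open>A Taylor estimate from differentiability of \<open>X'\<close> at the single point
  \<open>z0\<close>: it makes \<open>X' x - X' z0\<close> of size O(|x - z0|), and the mean value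
  inequality contributes the second factor.\<close>

lemma X_quadratic_remainder:
  obtains C where "0 < C"
    "\<forall>\<^sub>F w in nhds z0. norm (X w - X z0 - X' z0 (w - z0)) \<le> C * norm (w - z0) ^ 2"
proof -
  have "\<exists>B. 0 < B \<and> (\<forall>\<^sub>F w in nhds z0. norm (X' w b - X' z0 b) \<le> B * norm (w - z0))" for b
  proof -
    obtain D where D: "((\<lambda>x. X' x b) has_derivative D) (at z0)"
      using X'_diff unfolding differentiable_def by blast
    then obtain K where K: "0 < K" "\<And>u. norm (D u) \<le> norm u * K"
      using bounded_linear.pos_bounded has_derivative_bounded_linear by blast
    \<comment> \<open>Tolerance 1 in the definition of the derivative is enough; it accounts for the
      summand 1 in the constant \<open>K + 1\<close>.\<close>
    obtain d where d: "0 < d"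
      "\<And>y. norm (y - z0) < d \<Longrightarrow> norm (X' y b - X' z0 b - D (y - z0)) \<le> 1 * norm (y - z0)"
      using D unfolding has_derivative_at_alt by (metis zero_less_one)
    have "norm (X' y b - X' z0 b) \<le> (K + 1) * norm (y - z0)" if "dist y z0 < d" for y
      using d(2)[of y] K(2)[of "y - z0"] that
        norm_triangle_ineq[of "X' y b - X' z0 b - D (y - z0)" "D (y - z0)"]
      by (simp add: dist_norm algebra_simps)
    then show ?thesis
      using K(1) d(1) by (intro exI[of _ "K + 1"]) (auto simp: eventually_nhds_metric)
  qed
  then obtain B where B: "\<And>b. 0 < B b"
    "\<And>b. \<forall>\<^sub>F w in nhds z0. norm (X' w b - X' z0 b) \<le> B b * norm (w - z0)"
    by metis
  define C where "C = (\<Sum>b\<in>Basis. B b)"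
  have "0 < C"
    unfolding C_def by (intro sum_pos B) auto
  have "\<forall>\<^sub>F w in nhds z0. \<forall>b\<in>Basis. norm (X' w b - X' z0 b) \<le> B b * norm (w - z0)"
    using B by (intro eventually_ball_finite) auto
  then obtain d where d: "0 < d"
    "\<And>w b. dist w z0 < d \<Longrightarrow> b \<in> Basis \<Longrightarrow> norm (X' w b - X' z0 b) \<le> B b * norm (w - z0)"
    unfolding eventually_nhds_metric by blast
  have "norm (X w - X z0 - X' z0 (w - z0)) \<le> C * norm (w - z0) ^ 2" if "dist w z0 < d" for w
  proof -
    \<comment> \<open>With the linear part subtracted, the derivative vanishes at \<open>z0\<close>
      and is small on the ball of radius \<open>dist w z0\<close>, which is convex and contains both
      endpoints.\<close>
    let ?f = "\<lambda>x. X x - X' z0 x"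
    have "norm (?f w - ?f z0) \<le> C * norm (w - z0) * norm (w - z0)"
    proof (rule differentiable_bound[of "cball z0 (dist w z0)" ?f "\<lambda>x u. X' x u - X' z0 u"])
      fix x assume x: "x \<in> cball z0 (dist w z0)"
      show "(?f has_derivative (\<lambda>u. X' x u - X' z0 u)) (at x within cball z0 (dist w z0))"
        by (intro has_derivative_diff has_derivative_at_withinI[OF X_deriv]
            linear_imp_has_derivative linear_X')
      show "onorm (\<lambda>u. X' x u - X' z0 u) \<le> C * norm (w - z0)"
      proof (rule onorm_le)
        fix u
        have "norm (X' x u - X' z0 u) \<le> (\<Sum>b\<in>Basis. norm (X' x b - X' z0 b)) * norm u"
          by (rule norm_le_basis_sum) (intro linear_compose_sub linear_X')
        also have "(\<Sum>b\<in>Basis. norm (X' x b - X' z0 b)) \<le> (\<Sum>b\<in>Basis. B b * norm (w - z0))"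
        proof (rule sum_mono)
          fix b :: 'a assume "b \<in> Basis"
          then have "norm (X' x b - X' z0 b) \<le> B b * norm (x - z0)"
            using x that by (intro d(2)) (auto simp: dist_commute)
          also have "\<dots> \<le> B b * norm (w - z0)"
            using x B(1)[of b] by (intro mult_left_mono) (auto simp: dist_norm norm_minus_commute)
          finally show "norm (X' x b - X' z0 b) \<le> B b * norm (w - z0)" .
        qed
        also have "\<dots> = C * norm (w - z0)"
          by (simp add: C_def sum_distrib_right)
        finally show "norm (X' x u - X' z0 u) \<le> C * norm (w - z0) * norm u"
          by (simp add: mult_right_mono)
      qed
    qed (auto simp: dist_commute)
    moreover have "?f w - ?f z0 = X w - X z0 - X' z0 (w - z0)"
      by (simp add: linear_diff[OF linear_X'])
    ultimately show ?thesis
      by (simp add: power2_eq_square mult.assoc)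
  qed
  then show ?thesis
    using \<open>0 < C\<close> \<open>0 < d\<close> by (intro that[of C]) (auto simp: eventually_nhds_metric)
qed

end

section \<open>The implicit scheme near a point\<close>

text \<open>\<open>D\<close> and \<open>E\<close> stay abstract so that exchanging them gives
  another instance of the same locale, namely the adjoint method.\<close>

locale implicit_scheme = smooth_field X X'
  for X :: "'a::euclidean_space \<Rightarrow> 'a" and X' :: "'a \<Rightarrow> 'a \<Rightarrow> 'a" +
  fixes D E :: "'a \<Rightarrow> 'a"
  assumes linear_D: "linear D" and linear_E: "linear E" and D_plus_E: "D u + E u = u"
begin

definition step :: "real \<Rightarrow> 'a \<Rightarrow> 'a \<Rightarrow> bool" where
  "step h z z' \<longleftrightarrow> z' = z + h *\<^sub>R X (D z' + E z)"

definition sol :: "real \<Rightarrow> 'a \<Rightarrow> 'a" where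
  "sol h z = (ARG_MIN (dist z) z'. step h z z')"

lemma stage_diff: "(D z' + E z) - (D w' + E w) = D (z' - w') + E (z - w)"
  by (simp add: linear_diff[OF linear_D] linear_diff[OF linear_E])

text \<open>\<open>\<eta>\<close> limits the data and \<open>s\<close> the ball in which solutions
  are unique. The Lipschitz clause serves the continuity of \<open>sol h\<close>, the last clause
  the invertibility of \<open>I - h D X'\<close> at the stage value.\<close>

definition solves_near :: "'a \<Rightarrow> real \<Rightarrow> real \<Rightarrow> real \<Rightarrow> bool" where
  "solves_near z0 s \<eta> M \<longleftrightarrow> (\<forall>h z. \<bar>h\<bar> < \<eta> \<longrightarrow> dist z z0 < \<eta> \<longrightarrow>
     sol h z \<in> ball z0 s \<and>
     (\<forall>z'\<in>ball z0 s. step h z z' \<longleftrightarrow> z' = sol h z) \<and>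
     dist (sol h z) z \<le> M * \<bar>h\<bar> \<and>
     (\<forall>w. dist w z0 < \<eta> \<longrightarrow> dist (sol h z) (sol h w) \<le> 3 * dist z w) \<and>
     (\<forall>u. norm (h *\<^sub>R D (X' (D (sol h z) + E z) u)) \<le> norm u / 2))"

lemma solves_nearD:
  assumes "solves_near z0 s \<eta> M" "\<bar>h\<bar> < \<eta>" "dist z z0 < \<eta>"
  shows "sol h z \<in> ball z0 s"
    and "z' \<in> ball z0 s \<Longrightarrow> step h z z' \<longleftrightarrow> z' = sol h z"
    and "dist (sol h z) z \<le> M * \<bar>h\<bar>"
    and "dist w z0 < \<eta> \<Longrightarrow> dist (sol h z) (sol h w) \<le> 3 * dist z w"
    and "norm (h *\<^sub>R D (X' (D (sol h z) + E z) u)) \<le> norm u / 2"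
  using assms unfolding solves_near_def by blast+

text \<open>Banach's fixed point theorem for \<open>z + h X(D z' + E z)\<close> as a map of
  \<open>z'\<close> on \<open>cball z0 s\<close>, followed by a comparison of distances that
  identifies the fixed point with the choice made by \<open>sol\<close>.\<close>

lemma local_solution:
  obtains s \<eta> M where "0 < s" "0 < \<eta>" "0 < M" "solves_near z0 s \<eta> M"
proof -
  obtain M L where M: "0 < M" and L: "0 < L"
    and XM: "\<And>w. dist w z0 \<le> 1 \<Longrightarrow> norm (X w) \<le> M"
    and X'L: "\<And>w u. dist w z0 \<le> 1 \<Longrightarrow> norm (X' w u) \<le> L * norm u"
    and XL: "\<And>v w. dist v z0 \<le> 1 \<Longrightarrow> dist w z0 \<le> 1 \<Longrightarrow> norm (X v - X w) \<le> L * norm (v - w)"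
    using X_bounds[of z0] by metis
  obtain cD cE where cD: "0 < cD" "\<And>u. norm (D u) \<le> norm u * cD"
    and cE: "0 < cE" "\<And>u. norm (E u) \<le> norm u * cE"
    using linear_D linear_E bounded_linear.pos_bounded linear_conv_bounded_linear by metis
  define c where "c = cD + cE"
  have c: "0 < c" "norm (D u) \<le> c * norm u" "norm (E u) \<le> c * norm u" for u
    using cD(1) cE(1) mult_right_mono[of cD c "norm u"] mult_right_mono[of cE c "norm u"]
      cD(2)[of u] cE(2)[of u] by (auto simp: c_def mult.commute)
  \<comment> \<open>If both endpoints lie within \<open>s\<close> of \<open>z0\<close>, the stage
    value lies within \<open>c * s + c * s = 1\<close> of it, hence in the ball where the bounds
    \<open>M\<close> and \<open>L\<close> hold.\<close>
  define s where "s = 1 / (2 * c)"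
  have s: "0 < s" "2 * (c * s) = 1"
    using c(1) by (auto simp: s_def)
  \<comment> \<open>The three entries keep the starting point within \<open>s / 4\<close> of the
    centre, the displacement \<open>\<bar>h\<bar> * M\<close> below \<open>s / 4\<close>, and the
    contraction factor \<open>\<bar>h\<bar> * L * c\<close> below 1/2.\<close>
  define \<eta> where "\<eta> = min (s / 4) (min (s / (4 * M)) (1 / (2 * L * c)))"
  have \<eta>: "0 < \<eta>" "\<eta> \<le> s / 4" "\<eta> \<le> s / (4 * M)" "\<eta> \<le> 1 / (2 * L * c)"
    using s M L c(1) by (auto simp: \<eta>_def)
  have hM: "\<bar>h\<bar> * M < s / 4" and hL: "\<bar>h\<bar> * L * c < 1 / 2" if "\<bar>h\<bar> < \<eta>" for h
  proof -
    have "\<bar>h\<bar> < s / (4 * M)" "\<bar>h\<bar> < 1 / (2 * L * c)" using that \<eta> by linarith+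
    then show "\<bar>h\<bar> * M < s / 4" "\<bar>h\<bar> * L * c < 1 / 2"
      using M L c(1) by (simp_all add: field_simps)
  qed
  have stage: "dist (D z' + E z) z0 \<le> 1" if "z \<in> cball z0 s" "z' \<in> cball z0 s" for z z'
  proof -
    have "(D z' + E z) - z0 = D (z' - z0) + E (z - z0)"
      using stage_diff[of z' z z0 z0] D_plus_E[of z0] by simp
    then have "dist (D z' + E z) z0 \<le> c * norm (z' - z0) + c * norm (z - z0)"
      by (metis dist_norm norm_triangle_mono c(2,3))
    also have "\<dots> \<le> c * s + c * s"
      using that c(1) by (intro add_mono mult_left_mono) (auto simp: dist_norm norm_minus_commute)
    finally show ?thesis using s by simp
  qed
  \<comment> \<open>One estimate with two uses: for equal starting points it is the contraction
    property, for different ones it gives the Lipschitz bound on \<open>sol h\<close>.\<close>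
  have X_lip: "norm (h *\<^sub>R X (D v + E z) - h *\<^sub>R X (D w + E y)) \<le> (norm (v - w) + norm (z - y)) / 2"
    if "\<bar>h\<bar> < \<eta>" "z \<in> cball z0 s" "y \<in> cball z0 s" "v \<in> cball z0 s" "w \<in> cball z0 s" for h z y v w
  proof -
    have "norm (X (D v + E z) - X (D w + E y)) \<le> L * norm (D (v - w) + E (z - y))"
      using XL[OF stage stage] that stage_diff by metis
    also have "\<dots> \<le> L * (c * norm (v - w) + c * norm (z - y))"
      using L c by (intro mult_left_mono norm_triangle_mono) auto
    finally have "\<bar>h\<bar> * norm (X (D v + E z) - X (D w + E y))
        \<le> \<bar>h\<bar> * (L * (c * norm (v - w) + c * norm (z - y)))"
      by (rule mult_left_mono) auto
    also have "\<dots> = (\<bar>h\<bar> * L * c) * (norm (v - w) + norm (z - y))"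
      by (simp add: algebra_simps)
    also have "\<dots> \<le> 1 / 2 * (norm (v - w) + norm (z - y))"
      using hL[OF that(1)] by (intro mult_right_mono) auto
    finally show ?thesis
      by (simp flip: scaleR_diff_right)
  qed
  have sol: "step h z (sol h z) \<and> dist (sol h z) z \<le> M * \<bar>h\<bar> \<and> sol h z \<in> ball z0 s
      \<and> (\<forall>z'\<in>cball z0 s. step h z z' \<longrightarrow> z' = sol h z)"
    if h: "\<bar>h\<bar> < \<eta>" and z: "dist z z0 < \<eta>" for h z
  proof -
    have zs: "z \<in> cball z0 s" and zs4: "dist z z0 < s / 4"
      using z \<eta>(2) s by (auto simp: dist_commute)
    let ?T = "\<lambda>z'. z + h *\<^sub>R X (D z' + E z)"
    have near: "dist (?T z') z \<le> M * \<bar>h\<bar>" if "z' \<in> cball z0 s" for z'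
      using mult_left_mono[OF XM[OF stage[OF zs that]], of "\<bar>h\<bar>"]
      by (simp add: dist_norm mult.commute)
    have "\<exists>!z'\<in>cball z0 s. ?T z' = z'"
    proof (rule Banach_fix[where c = "1/2"])
      show "?T ` cball z0 s \<subseteq> cball z0 s"
      proof clarify
        fix z' assume "z' \<in> cball z0 s"
        then have "dist (?T z') z0 \<le> M * \<bar>h\<bar> + s / 4"
          using near zs4 dist_triangle[of "?T z'" z0 z] by fastforce
        then show "?T z' \<in> cball z0 s"
          using hM[OF h] s by (simp add: dist_commute mult.commute)
      qed
      show "dist (?T v) (?T w) \<le> 1 / 2 * dist v w" if "v \<in> cball z0 s" "w \<in> cball z0 s" for v w
        using X_lip[OF h zs zs that] by (simp add: dist_norm)
    qed (use s in \<open>auto simp: complete_eq_closed\<close>)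
    then obtain z' where z': "z' \<in> cball z0 s" "step h z z'"
      and uniq: "\<And>w. w \<in> cball z0 s \<Longrightarrow> step h z w \<Longrightarrow> w = z'"
      unfolding step_def by metis
    have dz': "dist z' z \<le> M * \<bar>h\<bar>"
      using near[OF z'(1)] z'(2) unfolding step_def by metis
    \<comment> \<open>A solution outside the ball has distance more than \<open>3 * s / 4\<close>
      from \<open>z\<close>, while the fixed point is closer than \<open>s / 4\<close>. So the fixed
      point is the only minimiser, and the arbitrary choice in \<open>arg_min\<close> must return
      it.\<close>
    have far: "dist z z' < dist z w" if "step h z w" "w \<noteq> z'" for w
    proof -
      have "w \<notin> cball z0 s" using uniq that by blast
      then have "s < dist z0 z + dist z w"
        using dist_triangle[of z0 w z] by (simp add: dist_commute)
      then show ?thesis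
        using zs4 dz' hM[OF h] s by (simp add: dist_commute mult.commute)
    qed
    have "is_arg_min (dist z) (step h z) (sol h z)"
      unfolding sol_def arg_min_def
      by (rule someI[of _ z']) (use z' far in \<open>force simp: is_arg_min_def\<close>)
    then have "sol h z = z'"
      using far z'(2) unfolding is_arg_min_def by blast
    moreover have "dist z' z0 < s"
      using dist_triangle[of z' z0 z] dz' hM[OF h] zs4 s by (simp add: mult.commute)
    ultimately show ?thesis
      using z' uniq dz' by (auto simp: dist_commute)
  qed
  have cb: "z \<in> cball z0 s" "sol h z \<in> cball z0 s" if "\<bar>h\<bar> < \<eta>" "dist z z0 < \<eta>" for h z
    using sol[OF that] that(2) \<eta>(2) s by (auto simp: dist_commute)
  have lip: "dist (sol h z) (sol h w) \<le> 3 * dist z w"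
    if h: "\<bar>h\<bar> < \<eta>" and z: "dist z z0 < \<eta>" and w: "dist w z0 < \<eta>" for h z w
  proof -
    have "sol h z - sol h w
        = (z - w) + (h *\<^sub>R X (D (sol h z) + E z) - h *\<^sub>R X (D (sol h w) + E w))"
      using sol[OF h z] sol[OF h w] unfolding step_def by (simp add: algebra_simps)
    \<comment> \<open>With \<open>n\<close> the distance of the solutions and \<open>d\<close> that
      of the starting points this reads \<open>n \<le> d + (n + d) / 2\<close>, which is where the
      constant 3 comes from.\<close>
    then have "norm (sol h z - sol h w)
        \<le> norm (z - w) + (norm (sol h z - sol h w) + norm (z - w)) / 2"
      using norm_triangle_mono[OF order_refl
          X_lip[OF h cb(1)[OF h z] cb(1)[OF h w] cb(2)[OF h z] cb(2)[OF h w]], of "z - w"]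
      by simp
    then show ?thesis
      by (simp add: dist_norm field_simps)
  qed
  have small: "norm (h *\<^sub>R D (X' (D (sol h z) + E z) u)) \<le> norm u / 2"
    if h: "\<bar>h\<bar> < \<eta>" and z: "dist z z0 < \<eta>" for h z u
  proof -
    let ?k = "X' (D (sol h z) + E z) u"
    have "norm (h *\<^sub>R D ?k) \<le> \<bar>h\<bar> * (c * norm ?k)"
      using c(2)[of ?k] by (simp add: mult_left_mono)
    also have "\<dots> \<le> \<bar>h\<bar> * (c * (L * norm u))"
      using c(1) X'L[OF stage[OF cb[OF h z]]] by (intro mult_left_mono) auto
    also have "\<dots> = (\<bar>h\<bar> * L * c) * norm u"
      by simp
    also have "\<dots> \<le> 1 / 2 * norm u"
      using hL[OF h] by (intro mult_right_mono) auto
    finally show ?thesis by simp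
  qed
  have "solves_near z0 s \<eta> M"
    unfolding solves_near_def
  proof (intro allI impI)
    fix h z assume hz: "\<bar>h\<bar> < \<eta>" "dist z z0 < \<eta>"
    have "\<forall>z'\<in>ball z0 s. step h z z' \<longleftrightarrow> z' = sol h z"
      using sol[OF hz] ball_subset_cball by blast
    then show "sol h z \<in> ball z0 s \<and>
      (\<forall>z'\<in>ball z0 s. step h z z' \<longleftrightarrow> z' = sol h z) \<and>
      dist (sol h z) z \<le> M * \<bar>h\<bar> \<and>
      (\<forall>w. dist w z0 < \<eta> \<longrightarrow> dist (sol h z) (sol h w) \<le> 3 * dist z w) \<and>
      (\<forall>u. norm (h *\<^sub>R D (X' (D (sol h z) + E z) u)) \<le> norm u / 2)"
      using sol[OF hz] lip[OF hz] small[OF hz] by blast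
  qed
  with s \<eta>(1) M show thesis
    by (intro that)
qed

end

section \<open>Adjoint methods\<close>

definition near_identity :: "(real \<Rightarrow> 'a::topological_space \<Rightarrow> 'a) \<Rightarrow> bool" where
  "near_identity F \<longleftrightarrow> (\<forall>z0. ((\<lambda>(h, z). F h z) \<longlongrightarrow> z0) (nhds (0, z0)))"

definition locally_inverts :: "(real \<Rightarrow> 'a::topological_space \<Rightarrow> 'a) \<Rightarrow> (real \<Rightarrow> 'a \<Rightarrow> 'a) \<Rightarrow> bool" where
  "locally_inverts G F \<longleftrightarrow> (\<forall>z0. \<forall>\<^sub>F (h, z) in nhds (0, z0). G h (F (- h) z) = z)"

lemma filterlim_scale_step:
  fixes z0 :: "'a::topological_space"
  shows "filterlim (\<lambda>(h, z). (c * h, z)) (nhds (0 :: real, z0)) (nhds (0, z0))"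
proof -
  have "((\<lambda>x. c * fst x) \<longlongrightarrow> 0) (nhds (0 :: real, z0))"
    by (rule tendsto_eq_intros tendsto_fst filterlim_ident | simp)+
  moreover have "((\<lambda>x. snd x) \<longlongrightarrow> z0) (nhds (0 :: real, z0))"
    by (rule tendsto_eq_intros tendsto_snd filterlim_ident | simp)+
  ultimately show ?thesis
    unfolding case_prod_unfold by (rule tendsto_Pair)
qed

lemma near_identity_scaled:
  assumes "near_identity F"
  shows "near_identity (\<lambda>h. F (d * h))"
  unfolding near_identity_def
proof
  fix z0
  have "((\<lambda>(h, z). F h z) \<longlongrightarrow> z0) (nhds (0, z0))"
    using assms by (simp add: near_identity_def)
  from filterlim_compose[OF this filterlim_scale_step[of d z0]]
  show "((\<lambda>(h, z). F (d * h) z) \<longlongrightarrow> z0) (nhds (0, z0))"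
    by (simp add: case_prod_unfold)
qed

lemma eventually_scale_step:
  fixes z0 :: "'a::topological_space"
  assumes "\<forall>\<^sub>F (h :: real, z) in nhds (0, z0). P h z"
  shows "\<forall>\<^sub>F (h, z) in nhds (0, z0). P (c * h) z"
  using filterlim_iff[THEN iffD1, OF filterlim_scale_step[of c z0], rule_format, OF assms]
  by (simp add: case_prod_unfold)

text \<open>The substitution rule for local statements: \<open>(h, z)\<close> is replaced by
  \<open>(c * h, F (d * h) z)\<close>, which still tends to \<open>(0, z0)\<close>. The factors
  \<open>c\<close> and \<open>d\<close> are independent because compositions mix steps of opposite
  sign.\<close>

lemma eventually_after_step:
  assumes "near_identity F" "\<forall>\<^sub>F (h, z) in nhds (0, z0). P h z"
  shows "\<forall>\<^sub>F (h, z) in nhds (0, z0). P (c * h) (F (d * h) z)"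
proof -
  have "((\<lambda>(h, z). F (d * h) z) \<longlongrightarrow> z0) (nhds (0, z0))"
    using near_identity_scaled[OF assms(1), of d] by (simp add: near_identity_def)
  moreover have "((\<lambda>x. c * fst x) \<longlongrightarrow> 0) (nhds (0 :: real, z0))"
    by (rule tendsto_eq_intros tendsto_fst filterlim_ident | simp)+
  ultimately have "((\<lambda>x. (c * fst x, F (d * fst x) (snd x))) \<longlongrightarrow> (0, z0)) (nhds (0, z0))"
    by (intro tendsto_Pair) (auto simp: case_prod_unfold)
  from filterlim_iff[THEN iffD1, OF this, rule_format, OF assms(2)] show ?thesis
    by (simp add: case_prod_unfold)
qed

lemma near_identity_compose:
  assumes "near_identity F" "near_identity G"
  shows "near_identity (\<lambda>h. F (c * h) \<circ> G (d * h))"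
  unfolding near_identity_def
proof
  fix z0
  have "\<forall>\<^sub>F (h, z) in nhds (0, z0). F h z \<in> S" if "open S" "z0 \<in> S" for S
    using topological_tendstoD[OF assms(1)[unfolded near_identity_def, rule_format] that]
    by (simp add: case_prod_unfold)
  then have "\<forall>\<^sub>F (h, z) in nhds (0, z0). F (c * h) (G (d * h) z) \<in> S" if "open S" "z0 \<in> S" for S
    using eventually_after_step[OF assms(2)] that by fast
  then show "((\<lambda>(h, z). (F (c * h) \<circ> G (d * h)) z) \<longlongrightarrow> z0) (nhds (0, z0))"
    by (intro topological_tendstoI) (simp add: case_prod_unfold)
qed

text \<open>\<open>is_adjoint\<close> asks for neighbourhoods that do not depend on
  \<open>h\<close>; a box inside the open set of the product topology supplies them.\<close>

lemma eventually_step_rectangle: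
  fixes z0 :: "'a::topological_space"
  assumes "\<forall>\<^sub>F (h :: real, z) in nhds (0, z0). P h z"
  obtains h0 U where "0 < h0" "open U" "z0 \<in> U" "\<And>h z. \<bar>h\<bar> < h0 \<Longrightarrow> z \<in> U \<Longrightarrow> P h z"
proof -
  obtain S where S: "open S" "(0, z0) \<in> S" "\<forall>(h, z)\<in>S. P h z"
    using assms unfolding eventually_nhds by blast
  then obtain A B where AB: "open A" "open B" "0 \<in> A" "z0 \<in> B" "A \<times> B \<subseteq> S"
    by (metis open_prod_elim mem_Sigma_iff)
  then obtain e where "0 < e" "ball 0 e \<subseteq> A"
    using open_contains_ball by blast
  moreover have "P h z" if "h \<in> A" "z \<in> B" for h z
    using AB(5) S(3) that by blast
  ultimately show thesis
    using AB(2,4) by (intro that[of e B]) (auto simp: subset_iff)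
qed

lemma eventually_small:
  fixes z0 :: "'a::metric_space"
  assumes "0 < \<eta>"
  shows "\<forall>\<^sub>F (h :: real, z) in nhds (0, z0). \<bar>h\<bar> < \<eta> \<and> dist z z0 < \<eta>"
proof -
  have "\<forall>\<^sub>F x in nhds (0 :: real, z0). x \<in> ball 0 \<eta> \<times> ball z0 \<eta>"
    using assms by (intro eventually_nhds_in_open open_Times) auto
  then show ?thesis
    by eventually_elim (auto simp: dist_commute)
qed

text \<open>The left inverse gives injectivity on some \<open>U\<close>. Shrinking to a
  \<open>V\<close> that \<open>G h\<close> maps into \<open>U\<close> makes \<open>G h w\<close> a
  preimage in \<open>U\<close>, which gives surjectivity onto \<open>V\<close> and the value of
  \<open>inv_into\<close>.\<close>

lemma is_adjointI:
  assumes "near_identity G" "locally_inverts G F" "locally_inverts F G"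
  shows "is_adjoint F G"
  unfolding is_adjoint_def
proof
  fix z0
  have "\<forall>\<^sub>F (h, z) in nhds (0, z0). G h (F (- h) z) = z"
    using assms(2) by (simp add: locally_inverts_def)
  then obtain h1 U where U: "0 < h1" "open U" "z0 \<in> U"
    "\<And>h z. \<bar>h\<bar> < h1 \<Longrightarrow> z \<in> U \<Longrightarrow> G h (F (- h) z) = z"
    by (rule eventually_step_rectangle) blast
  have "\<forall>\<^sub>F (h, z) in nhds (0, z0). F (- h) (G h z) = z"
    \<comment> \<open>The hypothesis reads \<open>F h (G (- h) z) = z\<close>; the factor -1 moves
      the sign to \<open>F\<close>.\<close>
    using eventually_scale_step[OF assms(3)[unfolded locally_inverts_def, rule_format], of "-1"]
    by simp
  moreover have "\<forall>\<^sub>F (h, z) in nhds (0, z0). G h z \<in> U"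
    using topological_tendstoD[OF assms(1)[unfolded near_identity_def, rule_format] U(2,3)]
    by (simp add: case_prod_unfold)
  ultimately have "\<forall>\<^sub>F (h, z) in nhds (0, z0). F (- h) (G h z) = z \<and> G h z \<in> U"
    by eventually_elim auto
  then obtain h2 V where V: "0 < h2" "open V" "z0 \<in> V"
    "\<And>h z. \<bar>h\<bar> < h2 \<Longrightarrow> z \<in> V \<Longrightarrow> F (- h) (G h z) = z \<and> G h z \<in> U"
    by (rule eventually_step_rectangle) blast
  have "inj_on (F (- h)) U \<and> V \<subseteq> F (- h) ` U \<and> (\<forall>w\<in>V. G h w = inv_into U (F (- h)) w)"
    if h: "\<bar>h\<bar> < min h1 h2" for h
  proof -
    have inj: "inj_on (F (- h)) U"
      using U(4) h by (intro inj_on_inverseI[of _ "G h"]) auto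
    moreover have "G h w = inv_into U (F (- h)) w" if "w \<in> V" for w
      using V(4)[of h w] h that inv_into_f_f[OF inj, of "G h w"] by simp
    moreover have "V \<subseteq> F (- h) ` U"
      using V(4)[of h] h by force
    ultimately show ?thesis by blast
  qed
  then show "\<exists>U V h0. open U \<and> z0 \<in> U \<and> open V \<and> z0 \<in> V \<and> h0 > 0 \<and>
       (\<forall>h. \<bar>h\<bar> < h0 \<longrightarrow>
          inj_on (F (- h)) U \<and> V \<subseteq> F (- h) ` U \<and>
          (\<forall>w\<in>V. G h w = inv_into U (F (- h)) w))"
    using U V by (intro exI[of _ U] exI[of _ V] exI[of _ "min h1 h2"]) auto
qed

text \<open>Near \<open>z0\<close> the point \<open>G h w\<close> lies in the set \<open>U\<close>
  on which \<open>F (- h)\<close> is injective and is a preimage of \<open>w\<close>, so it is the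
  value that \<open>inv_into\<close> returns.\<close>

lemma adjoint_locally_unique:
  assumes "is_adjoint F A" "near_identity G" "locally_inverts F G"
  shows "locally_equal A G"
  unfolding locally_equal_def
proof
  fix z0
  obtain U V h0 where UV: "open U" "z0 \<in> U" "open V" "z0 \<in> V" "h0 > 0"
    and adj: "\<And>h. \<bar>h\<bar> < h0 \<Longrightarrow> inj_on (F (- h)) U"
      "\<And>h w. \<bar>h\<bar> < h0 \<Longrightarrow> w \<in> V \<Longrightarrow> A h w = inv_into U (F (- h)) w"
    using assms(1) unfolding is_adjoint_def by metis
  have "\<forall>\<^sub>F (h, z) in nhds (0, z0). F (- h) (G h z) = z"
    using eventually_scale_step[OF assms(3)[unfolded locally_inverts_def, rule_format], of "-1"]
    by simp
  moreover have "\<forall>\<^sub>F (h, z) in nhds (0, z0). G h z \<in> U"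
    using topological_tendstoD[OF assms(2)[unfolded near_identity_def, rule_format] UV(1,2)]
    by (simp add: case_prod_unfold)
  moreover have "\<forall>\<^sub>F x in nhds (0, z0). x \<in> ball 0 h0 \<times> V"
    using UV by (intro eventually_nhds_in_open open_Times) auto
  ultimately show "\<forall>\<^sub>F (h, z) in nhds (0, z0). A h z = G h z"
  proof eventually_elim
    case (elim x)
    then show ?case
      using adj(2) inv_into_f_f[OF adj(1), of "fst x" "G (fst x) (snd x)"]
      by (auto simp: dist_norm split: prod.splits)
  qed
qed

text \<open>In \<open>F k (G k (F (- k) (G (- k) z)))\<close> with \<open>k = h / 2\<close> the
  inner pair cancels first, at the displaced point \<open>G (- k) z\<close>, and then the outer pair
  cancels at \<open>z\<close>.\<close>

lemma locally_inverts_symmetric_composition: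
  assumes "near_identity F" "near_identity G" "locally_inverts G F" "locally_inverts F G"
  shows "locally_inverts (\<lambda>h. F (h / 2) \<circ> G (h / 2)) (\<lambda>h. F (h / 2) \<circ> G (h / 2))"
  unfolding locally_inverts_def
proof
  fix z0
  have "\<forall>\<^sub>F (h, z) in nhds (0, z0).
      G (1 / 2 * h) (F (- (1 / 2 * h)) (G (- 1 / 2 * h) z)) = G (- 1 / 2 * h) z"
    using eventually_after_step[OF assms(2) assms(3)[unfolded locally_inverts_def, rule_format],
        of "1 / 2" "- 1 / 2"] by simp
  moreover have "\<forall>\<^sub>F (h, z) in nhds (0, z0). F (1 / 2 * h) (G (- (1 / 2 * h)) z) = z"
    using assms(4) by (intro eventually_scale_step) (simp add: locally_inverts_def)
  ultimately show "\<forall>\<^sub>F (h, z) in nhds (0, z0).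
      (F (h / 2) \<circ> G (h / 2)) ((F (- h / 2) \<circ> G (- h / 2)) z) = z"
    by eventually_elim auto
qed

section \<open>The scheme, its reflection under the exchange of \<open>D\<close> and
  \<open>E\<close>, and the derivative of a step\<close>

context implicit_scheme
begin

text \<open>Exchanging \<open>D\<close> and \<open>E\<close> twice is the identity, so a lemma
  relating \<open>sol\<close> to \<open>adj.sol\<close> also yields, under the prefix
  \<open>adj\<close>, the same lemma with the two methods exchanged.\<close>

sublocale adj: implicit_scheme X X' E D
  by (intro implicit_scheme.intro implicit_scheme_axioms.intro smooth_field_axioms linear_D linear_E)
    (simp add: D_plus_E add.commute)

lemma adj_step_iff: "adj.step h z z' \<longleftrightarrow> step (- h) z' z"
  by (auto simp: step_def adj.step_def algebra_simps)

lemma near_identity_sol: "near_identity sol"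
  unfolding near_identity_def
proof
  fix z0
  obtain s \<eta> M where *: "0 < s" "0 < \<eta>" "0 < M" and near: "solves_near z0 s \<eta> M"
    by (rule local_solution)
  have "((\<lambda>(h, z). sol h z - z) \<longlongrightarrow> 0) (nhds (0, z0))"
  proof (rule Lim_null_comparison)
    show "\<forall>\<^sub>F x in nhds (0, z0). norm (case x of (h, z) \<Rightarrow> sol h z - z) \<le> M * \<bar>fst x\<bar>"
      using eventually_small[OF *(2), of z0] by eventually_elim (auto simp: solves_nearD(3)[OF near] simp flip: dist_norm)
    show "((\<lambda>x. M * \<bar>fst x\<bar>) \<longlongrightarrow> 0) (nhds (0 :: real, z0))"
      by (rule tendsto_eq_intros tendsto_fst filterlim_ident | simp)+
  qed
  from tendsto_add[OF this tendsto_snd[OF filterlim_ident]]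
  show "((\<lambda>(h, z). sol h z) \<longlongrightarrow> z0) (nhds (0, z0))"
    by (simp add: case_prod_unfold)
qed

lemma locally_defined_sol: "locally_defined_by sol step"
  unfolding locally_defined_by_def
proof (intro allI conjI)
  fix z0
  show "((\<lambda>(h, z). sol h z) \<longlongrightarrow> z0) (nhds (0, z0))"
    using near_identity_sol by (simp add: near_identity_def)
  obtain s \<eta> M where *: "0 < s" "0 < \<eta>" "0 < M" and near: "solves_near z0 s \<eta> M"
    by (rule local_solution)
  have "\<forall>\<^sub>F (h, z) in nhds (0, z0).
        sol h z \<in> ball z0 s \<and> (\<forall>z'\<in>ball z0 s. step h z z' \<longleftrightarrow> z' = sol h z)"
    using eventually_small[OF *(2), of z0] by eventually_elim (use solves_nearD(1,2)[OF near] in blast)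
  then show "\<exists>\<delta>>0. \<forall>\<^sub>F (h, z) in nhds (0, z0).
        sol h z \<in> ball z0 \<delta> \<and> (\<forall>z'\<in>ball z0 \<delta>. step h z z' \<longleftrightarrow> z' = sol h z)"
    using *(1) by blast
qed

lemma eventually_step_sol: "\<forall>\<^sub>F (h, z) in nhds (0, z0). step h z (sol h z)"
proof -
  obtain \<delta> where "\<forall>\<^sub>F (h, z) in nhds (0, z0).
      sol h z \<in> ball z0 \<delta> \<and> (\<forall>z'\<in>ball z0 \<delta>. step h z z' \<longleftrightarrow> z' = sol h z)"
    using locally_defined_sol[unfolded locally_defined_by_def, rule_format, of z0] by blast
  then show ?thesis by eventually_elim auto
qed

end

\<comment> \<open>The facts above become available for \<open>adj\<close> only when the locale is re-entered.\<close>
context implicit_scheme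
begin

text \<open>By \<open>adj_step_iff\<close> the point \<open>z\<close> solves the exchanged equation
  started at \<open>sol (- h) z\<close>. It lies in the ball of uniqueness, so it is what
  \<open>adj.sol h\<close> returns.\<close>

lemma locally_inverts_adj_sol: "locally_inverts adj.sol sol"
  unfolding locally_inverts_def
proof
  fix z0
  obtain \<delta> where \<delta>: "0 < \<delta>" "\<forall>\<^sub>F (h, z) in nhds (0, z0).
      adj.sol h z \<in> ball z0 \<delta> \<and> (\<forall>z'\<in>ball z0 \<delta>. adj.step h z z' \<longleftrightarrow> z' = adj.sol h z)"
    using adj.locally_defined_sol[unfolded locally_defined_by_def, rule_format, of z0] by blast
  have "\<forall>\<^sub>F (h, z) in nhds (0, z0). \<forall>z'\<in>ball z0 \<delta>.
      adj.step h (sol (- h) z) z' \<longleftrightarrow> z' = adj.sol h (sol (- h) z)"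
    using eventually_after_step[OF near_identity_sol \<delta>(2), of 1 "-1"]
    by eventually_elim auto
  moreover have "\<forall>\<^sub>F (h, z) in nhds (0, z0). step (- h) z (sol (- h) z)"
    using eventually_scale_step[OF eventually_step_sol, of "-1"] by simp
  ultimately show "\<forall>\<^sub>F (h, z) in nhds (0, z0). adj.sol h (sol (- h) z) = z"
    using eventually_small[OF \<delta>(1), of z0]
    by eventually_elim (auto simp: adj_step_iff dist_commute)
qed

text \<open>The variable \<open>v\<close> is the variation of the stage value:
  \<open>u = A v\<close> and \<open>S u = B v\<close> encode \<open>S = B A^{-1}\<close> without
  naming the inverse, which is the form in which invariance of the symplectic form is
  checked.\<close>

lemma sol_derivative:
  "\<forall>\<^sub>F (h, z) in nhds (0, z0). \<exists>w S. (sol h has_derivative S) (at z) \<and>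
     (\<forall>u. \<exists>v. u = v - h *\<^sub>R D (X' w v) \<and> S u = v + h *\<^sub>R E (X' w v))"
proof -
  obtain s \<eta> M where *: "0 < s" "0 < \<eta>" "0 < M" and near: "solves_near z0 s \<eta> M"
    by (rule local_solution)
  have "\<exists>w S. (sol h has_derivative S) (at z) \<and>
     (\<forall>u. \<exists>v. u = v - h *\<^sub>R D (X' w v) \<and> S u = v + h *\<^sub>R E (X' w v))"
    if h: "\<bar>h\<bar> < \<eta>" and z: "dist z z0 < \<eta>" for h z
  proof -
    \<comment> \<open>In terms of the stage value \<open>w\<close> both endpoints are explicit:
      \<open>z = w - h D X(w)\<close> and \<open>z' = w + h E X(w)\<close>.\<close>
    let ?g = "\<lambda>z. D (sol h z) + E z" and ?a = "\<lambda>w. w - h *\<^sub>R D (X w)"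
    define w where "w = ?g z"
    define a' where "a' v = v - h *\<^sub>R D (X' w v)" for v
    have sol: "sol h y = y + h *\<^sub>R X (?g y)" if "y \<in> ball z0 \<eta>" for y
      using solves_nearD(1,2)[OF near h, of y] that unfolding step_def by (auto simp: dist_commute)
    have ag: "?a (?g y) = y" if "y \<in> ball z0 \<eta>" for y
    proof -
      have "h *\<^sub>R D (X (?g y)) = D (sol h y - y)"
        using sol[OF that] by (metis add_diff_cancel_left' linear_cmul[OF linear_D])
      moreover have "E y = y - D y"
        using D_plus_E[of y] by (simp add: eq_diff_eq add.commute)
      ultimately show ?thesis
        by (simp add: linear_diff[OF linear_D])
    qed
    have a'_deriv: "(?a has_derivative a') (at (?g z))"
      unfolding a'_def w_def
      by (intro has_derivative_diff has_derivative_ident has_derivative_scaleR_right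
          bounded_linear.has_derivative[OF linear_conv_bounded_linear[THEN iffD1, OF linear_D]] X_deriv)
    have lin_a': "linear a'"
      using a'_deriv by (rule has_derivative_linear)
    \<comment> \<open>A kernel vector equals its own image under \<open>h D X'\<close>, which at
      least halves norms.\<close>
    have "v = 0" if "a' v = 0" for v
    proof -
      have "v = h *\<^sub>R D (X' (?g z) v)"
        using that by (simp add: a'_def w_def)
      from arg_cong[OF this, of norm] have "norm v \<le> norm v / 2"
        using solves_nearD(5)[OF near h z, of v] by linarith
      then show "v = 0" by simp
    qed
    then have "inj a'"
      by (subst linear_injective_0[OF lin_a']) blast
    then obtain g' where g': "linear g'" "\<And>x. g' (a' x) = x" "\<And>x. a' (g' x) = x"
      using eucl.linear_injective_isomorphism[OF lin_a'] by auto
    \<comment> \<open>The inverse function rule below asks for a continuous right inverse;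
      continuity comes from the Lipschitz constant 3.\<close>
    have "isCont (sol h) z"
    proof -
      have "continuous_on (ball z0 \<eta>) (sol h)"
        by (rule lipschitz_on_continuous_on[of 3]) (auto simp: lipschitz_on_def solves_nearD(4)[OF near h] dist_commute)
      then show ?thesis
        using z by (simp add: continuous_on_eq_continuous_at dist_commute)
    qed
    then have cont: "isCont ?g z"
      using linear_D linear_E unfolding linear_conv_bounded_linear
      by (intro continuous_add bounded_linear.isCont[of D] bounded_linear.isCont[of E] continuous_ident)
    have dg: "(?g has_derivative g') (at z)"
      using z g' by (intro has_derivative_inverse_basic[OF a'_deriv _ _ cont open_ball[of z0 \<eta>]] ag)
        (auto simp: linear_conv_bounded_linear dist_commute fun_eq_iff)
    have "((\<lambda>y. y + h *\<^sub>R X (?g y)) has_derivative (\<lambda>u. u + h *\<^sub>R X' w (g' u))) (at z)"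
      unfolding w_def
      by (intro has_derivative_add has_derivative_ident has_derivative_scaleR_right
          diff_chain_at[OF dg X_deriv, unfolded o_def])
    then have S: "(sol h has_derivative (\<lambda>u. u + h *\<^sub>R X' w (g' u))) (at z)"
      by (rule has_derivative_transform_within_open[OF _ open_ball[of z0 \<eta>]])
        (use z sol in \<open>auto simp: dist_commute\<close>)
    have "u = g' u - h *\<^sub>R D (X' w (g' u)) \<and>
        u + h *\<^sub>R X' w (g' u) = g' u + h *\<^sub>R E (X' w (g' u))" for u
    proof -
      have "u = g' u - h *\<^sub>R D (X' w (g' u))"
        using g'(3)[of u] by (simp add: a'_def)
      moreover have "h *\<^sub>R D (X' w (g' u)) + h *\<^sub>R E (X' w (g' u)) = h *\<^sub>R X' w (g' u)"
        by (simp add: D_plus_E flip: scaleR_add_right)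
      ultimately show ?thesis by (metis add.assoc diff_add_cancel)
    qed
    with S show ?thesis by blast
  qed
  then show ?thesis
    by (intro eventually_mono[OF eventually_small[OF *(2), of z0]]) (auto split: prod.splits)
qed

end

section \<open>Gradient and Hessian\<close>

lemma smooth_imp_differentiable: "smooth f \<Longrightarrow> f differentiable (at x)"
  unfolding smooth_def by (metis k_times_differentiable.simps(2))

lemma smooth_directional_derivative:
  "smooth f \<Longrightarrow> smooth (\<lambda>x. frechet_derivative f (at x) v)"
  unfolding smooth_def by (metis k_times_differentiable.simps(2))

lemma smooth_imp_isCont: "smooth f \<Longrightarrow> isCont f x"
  by (simp add: differentiable_imp_continuous_within smooth_imp_differentiable)

lemma DERIV_along_line:
  fixes g :: "'a::real_normed_vector \<Rightarrow> real"
  assumes "smooth g"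
  shows "((\<lambda>t. g (y + t *\<^sub>R u)) has_real_derivative
    frechet_derivative g (at (y + t *\<^sub>R u)) u) (at t)"
proof -
  let ?g' = "frechet_derivative g (at (y + t *\<^sub>R u))"
  have g: "(g has_derivative ?g') (at (y + t *\<^sub>R u))"
    using smooth_imp_differentiable[OF assms] frechet_derivative_works by blast
  have "((\<lambda>t. y + t *\<^sub>R u) has_derivative (\<lambda>t. t *\<^sub>R u)) (at t)"
    by (auto intro!: derivative_eq_intros)
  from diff_chain_at[OF this g] show ?thesis
    using linear_cmul[OF has_derivative_linear[OF g]]
    by (auto simp: o_def has_field_derivative_def mult.commute[of _ "?g' u"])
qed

text \<open>The mean value theorem is applied twice: in direction \<open>u\<close> to the difference
  of \<open>f\<close> along two parallel lines offset by \<open>s *\<^sub>R v\<close>, then in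
  direction \<open>v\<close> to the directional derivative.\<close>

lemma second_difference_mean_value:
  fixes f :: "'a::real_normed_vector \<Rightarrow> real"
  assumes "smooth f" "0 < s"
  obtains a b where "0 < a" "a < s" "0 < b" "b < s"
    "f (x + s *\<^sub>R u + s *\<^sub>R v) - f (x + s *\<^sub>R u) - f (x + s *\<^sub>R v) + f x
      = s * s * frechet_derivative (\<lambda>x. frechet_derivative f (at x) u) (at (x + a *\<^sub>R u + b *\<^sub>R v)) v"
proof -
  let ?g = "\<lambda>x. frechet_derivative f (at x) u"
  let ?\<phi> = "\<lambda>t. f (x + s *\<^sub>R v + t *\<^sub>R u) - f (x + t *\<^sub>R u)"
  have "DERIV ?\<phi> t :> ?g (x + s *\<^sub>R v + t *\<^sub>R u) - ?g (x + t *\<^sub>R u)" for t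
    by (intro DERIV_diff DERIV_along_line assms)
  from MVT2[OF \<open>0 < s\<close>, of ?\<phi>, OF this] obtain a where a: "0 < a" "a < s"
    "?\<phi> s - ?\<phi> 0 = (s - 0) * (?g (x + s *\<^sub>R v + a *\<^sub>R u) - ?g (x + a *\<^sub>R u))"
    by blast
  have "DERIV (\<lambda>t. ?g (x + a *\<^sub>R u + t *\<^sub>R v)) t :>
      frechet_derivative ?g (at (x + a *\<^sub>R u + t *\<^sub>R v)) v" for t
    by (intro DERIV_along_line smooth_directional_derivative assms)
  from MVT2[OF \<open>0 < s\<close>, of "\<lambda>t. ?g (x + a *\<^sub>R u + t *\<^sub>R v)", OF this] obtain b where b: "0 < b" "b < s"
    "?g (x + a *\<^sub>R u + s *\<^sub>R v) - ?g (x + a *\<^sub>R u + 0 *\<^sub>R v)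
      = (s - 0) * frechet_derivative ?g (at (x + a *\<^sub>R u + b *\<^sub>R v)) v"
    by blast
  show thesis
  proof (rule that[OF a(1,2) b(1,2)])
    have "f (x + s *\<^sub>R u + s *\<^sub>R v) - f (x + s *\<^sub>R u) - f (x + s *\<^sub>R v) + f x = ?\<phi> s - ?\<phi> 0"
      by (simp add: add.assoc add.commute[of "s *\<^sub>R u"])
    also have "\<dots> = s * (?g (x + a *\<^sub>R u + s *\<^sub>R v) - ?g (x + a *\<^sub>R u + 0 *\<^sub>R v))"
      using a(3) by (simp add: add.assoc add.commute[of "s *\<^sub>R v"])
    also have "\<dots> = s * s * frechet_derivative ?g (at (x + a *\<^sub>R u + b *\<^sub>R v)) v"
      using b(3) by simp
    finally show "f (x + s *\<^sub>R u + s *\<^sub>R v) - f (x + s *\<^sub>R u) - f (x + s *\<^sub>R v) + f x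
      = s * s * frechet_derivative ?g (at (x + a *\<^sub>R u + b *\<^sub>R v)) v" .
  qed
qed

text \<open>The second difference is symmetric in \<open>u\<close> and \<open>v\<close>, so after
  division by \<open>s * s\<close> both mixed derivatives agree at two points within O(s) of
  \<open>x\<close>. Continuity of the second derivatives allows \<open>s\<close> to tend to
  0.\<close>

lemma mixed_derivatives_commute:
  fixes f :: "'a::real_normed_vector \<Rightarrow> real"
  assumes "smooth f"
  shows "frechet_derivative (\<lambda>x. frechet_derivative f (at x) u) (at x) v
    = frechet_derivative (\<lambda>x. frechet_derivative f (at x) v) (at x) u"
proof -
  let ?G = "\<lambda>u v x. frechet_derivative (\<lambda>x. frechet_derivative f (at x) u) (at x) v"
  have lim: "((\<lambda>s. ?G u v (p s)) \<longlongrightarrow> ?G u v x) (at_right 0)"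
    if p: "\<And>s. 0 < s \<Longrightarrow> norm (p s - x) \<le> s * (norm u + norm v)" for u v p
  proof -
    have "((\<lambda>s. p s - x) \<longlongrightarrow> 0) (at_right 0)"
    proof (rule Lim_null_comparison)
      show "\<forall>\<^sub>F s in at_right 0. norm (p s - x) \<le> s * (norm u + norm v)"
        using eventually_at_right_less[of 0] by eventually_elim (rule p)
      show "((\<lambda>s. s * (norm u + norm v)) \<longlongrightarrow> 0) (at_right 0)"
        by (auto intro!: tendsto_eq_intros)
    qed
    then have "(p \<longlongrightarrow> x) (at_right 0)"
      by (simp add: LIM_zero_iff)
    then show ?thesis
      by (intro isCont_tendsto_compose[of x "?G u v"] smooth_imp_isCont smooth_directional_derivative assms)
  qed
  have "\<exists>p q. norm (p - x) \<le> s * (norm u + norm v) \<and> norm (q - x) \<le> s * (norm v + norm u)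
      \<and> ?G u v p = ?G v u q" if "0 < s" for s
  proof -
    obtain a b where ab: "0 < a" "a < s" "0 < b" "b < s"
      "f (x + s *\<^sub>R u + s *\<^sub>R v) - f (x + s *\<^sub>R u) - f (x + s *\<^sub>R v) + f x
        = s * s * ?G u v (x + a *\<^sub>R u + b *\<^sub>R v)"
      by (rule second_difference_mean_value[OF assms \<open>0 < s\<close>])
    obtain c d where cd: "0 < c" "c < s" "0 < d" "d < s"
      "f (x + s *\<^sub>R v + s *\<^sub>R u) - f (x + s *\<^sub>R v) - f (x + s *\<^sub>R u) + f x
        = s * s * ?G v u (x + c *\<^sub>R v + d *\<^sub>R u)"
      by (rule second_difference_mean_value[OF assms \<open>0 < s\<close>])
    have "x + s *\<^sub>R v + s *\<^sub>R u = x + s *\<^sub>R u + s *\<^sub>R v"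
      by simp
    from cd(5)[unfolded this] have "s * s * ?G u v (x + a *\<^sub>R u + b *\<^sub>R v) = s * s * ?G v u (x + c *\<^sub>R v + d *\<^sub>R u)"
      using ab(5) by linarith
    then have eq: "?G u v (x + a *\<^sub>R u + b *\<^sub>R v) = ?G v u (x + c *\<^sub>R v + d *\<^sub>R u)"
      using that by simp
    have bound: "norm ((x + a *\<^sub>R u + b *\<^sub>R v) - x) \<le> s * (norm u + norm v)"
      if "0 < a" "a < s" "0 < b" "b < s" for a b and u v :: 'a
    proof -
      have "norm ((x + a *\<^sub>R u + b *\<^sub>R v) - x) \<le> a * norm u + b * norm v"
        using norm_triangle_ineq[of "a *\<^sub>R u" "b *\<^sub>R v"] that by (simp add: add.assoc)
      also have "\<dots> \<le> s * norm u + s * norm v"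
        using that by (intro add_mono mult_right_mono) auto
      finally show ?thesis by (simp add: algebra_simps)
    qed
    show ?thesis
      using bound[OF ab(1-4)] bound[OF cd(1-4)] eq by blast
  qed
  then obtain p q where p: "\<And>s. 0 < s \<Longrightarrow> norm (p s - x) \<le> s * (norm u + norm v)"
    and q: "\<And>s. 0 < s \<Longrightarrow> norm (q s - x) \<le> s * (norm v + norm u)"
    and pq: "\<And>s. 0 < s \<Longrightarrow> ?G u v (p s) = ?G v u (q s)"
    by metis
  have "\<forall>\<^sub>F s in at_right 0. ?G u v (p s) = ?G v u (q s)"
    using eventually_at_right_less[of 0] by eventually_elim (rule pq)
  from Lim_transform_eventually[OF lim[OF p] this] show ?thesis
    using lim[of q v u, OF q] tendsto_unique trivial_limit_at_right_real by blast
qed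

definition gradient :: "('a::euclidean_space \<Rightarrow> real) \<Rightarrow> 'a \<Rightarrow> 'a" where
  "gradient f z = (\<Sum>b\<in>Basis. frechet_derivative f (at z) b *\<^sub>R b)"

definition hessian :: "('a::euclidean_space \<Rightarrow> real) \<Rightarrow> 'a \<Rightarrow> 'a \<Rightarrow> 'a" where
  "hessian f z u =
    (\<Sum>b\<in>Basis. frechet_derivative (\<lambda>x. frechet_derivative f (at x) b) (at z) u *\<^sub>R b)"

lemma inner_gradient:
  assumes "smooth f"
  shows "gradient f z \<bullet> u = frechet_derivative f (at z) u"
proof -
  have "linear (frechet_derivative f (at z))"
    using smooth_imp_differentiable[OF assms] by (rule linear_frechet_derivative)
  then have "frechet_derivative f (at z) u = (\<Sum>b\<in>Basis. (u \<bullet> b) *\<^sub>R frechet_derivative f (at z) b)"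
    by (subst euclidean_representation[of u, symmetric])
      (simp only: linear_sum linear_cmul)
  then show ?thesis
    by (simp add: gradient_def inner_sum_left inner_commute[of u] mult.commute)
qed

lemma gradient_has_derivative:
  assumes "smooth f"
  shows "(gradient f has_derivative hessian f z) (at z)"
proof -
  have "((\<lambda>x. frechet_derivative f (at x) b) has_derivative
      frechet_derivative (\<lambda>x. frechet_derivative f (at x) b) (at z)) (at z)" for b
    using smooth_imp_differentiable[OF smooth_directional_derivative[OF assms]]
      frechet_derivative_works by blast
  then show ?thesis
    unfolding gradient_def hessian_def by (intro has_derivative_sum has_derivative_scaleR_left)
qed

lemma differentiable_hessian:
  assumes "smooth f"
  shows "(\<lambda>x. hessian f x u) differentiable (at z)"
  unfolding hessian_def
  by (intro differentiable_sum differentiable_scaleR differentiable_const smooth_imp_differentiable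
      smooth_directional_derivative assms finite_Basis ballI)

lemma hessian_symmetric:
  assumes "smooth f"
  shows "hessian f z u \<bullet> v = u \<bullet> hessian f z v"
proof -
  have lin: "linear (hessian f z)"
    using gradient_has_derivative[OF assms] by (rule has_derivative_linear)
  have basis: "hessian f z c \<bullet> b = hessian f z b \<bullet> c" if "b \<in> Basis" "c \<in> Basis" for b c
    using that mixed_derivatives_commute[OF assms, of b z c]
    by (simp add: hessian_def inner_sum_left inner_Basis if_distrib cong: if_cong)
  have expand: "hessian f z x \<bullet> y = (\<Sum>b\<in>Basis. \<Sum>c\<in>Basis. (x \<bullet> b) * (y \<bullet> c) * (hessian f z b \<bullet> c))"
    for x y
  proof -
    have "hessian f z x = (\<Sum>b\<in>Basis. (x \<bullet> b) *\<^sub>R hessian f z b)"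
      by (subst euclidean_representation[of x, symmetric]) (simp only: linear_sum[OF lin] linear_cmul[OF lin])
    then have "hessian f z x \<bullet> y = (\<Sum>b\<in>Basis. (x \<bullet> b) * (hessian f z b \<bullet> y))"
      by (simp add: inner_sum_left)
    also have "\<dots> = (\<Sum>b\<in>Basis. (x \<bullet> b) * (\<Sum>c\<in>Basis. (hessian f z b \<bullet> c) * (y \<bullet> c)))"
      by (subst euclidean_inner) simp
    finally show ?thesis
      by (simp add: sum_distrib_left mult_ac)
  qed
  have "hessian f z u \<bullet> v = (\<Sum>b\<in>Basis. \<Sum>c\<in>Basis. (u \<bullet> b) * (v \<bullet> c) * (hessian f z c \<bullet> b))"
    by (subst expand) (intro sum.cong refl, simp add: basis)
  also have "\<dots> = hessian f z v \<bullet> u"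
    by (subst sum.swap) (subst expand, simp only: mult.commute[of "u \<bullet> _"])
  finally show ?thesis by (simp add: inner_commute)
qed

section \<open>Symplecticity\<close>

text \<open>This is the bilinear form of \<open>J_mat\<close>, see
  \<open>inner_J_mat\<close>.\<close>

definition sympl_form :: "'d::finite phase \<Rightarrow> 'd phase \<Rightarrow> real" where
  "sympl_form z w = fst z \<bullet> snd w - snd z \<bullet> fst w"

text \<open>The inverse of J, equal to -J, so that the Hamiltonian field is this map applied to the
  gradient.\<close>

definition sympl_rot :: "'d::finite phase \<Rightarrow> 'd phase" where
  "sympl_rot z = (- snd z, fst z)"

text \<open>The weights of the new point in the stage value: the method puts \<open>lam\<close> on
  the new \<open>p\<close> but on the old \<open>q\<close>. The old point therefore carries
  \<open>partition_weight (1 - lam)\<close>.\<close>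

definition partition_weight :: "real \<Rightarrow> 'd::finite phase \<Rightarrow> 'd phase" where
  "partition_weight lam z = (lam *\<^sub>R fst z, (1 - lam) *\<^sub>R snd z)"

lemma linear_sympl_rot: "linear sympl_rot"
  by (rule linearI) (simp_all add: sympl_rot_def)

lemma linear_partition_weight: "linear (partition_weight lam)"
  by (rule linearI) (simp_all add: partition_weight_def scaleR_add_right)

lemma hamiltonian_field_eq:
  fixes H :: "'d::finite phase \<Rightarrow> real"
  assumes "smooth H"
  shows "hamiltonian_field H z = sympl_rot (gradient H z)"
proof -
  have p: "deriv (\<lambda>t. H (fst z + t *\<^sub>R axis i 1, snd z)) 0 = fst (gradient H z) $ i" for i
    using DERIV_along_line[OF assms, of z "(axis i 1, 0)" 0]
    by (intro DERIV_imp_deriv)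
      (simp add: plus_prod_def flip: inner_gradient[OF assms], simp add: inner_prod_def inner_axis)
  have q: "deriv (\<lambda>t. H (fst z, snd z + t *\<^sub>R axis i 1)) 0 = snd (gradient H z) $ i" for i
    using DERIV_along_line[OF assms, of z "(0, axis i 1)" 0]
    by (intro DERIV_imp_deriv)
      (simp add: plus_prod_def flip: inner_gradient[OF assms], simp add: inner_prod_def inner_axis)
  show ?thesis
    by (simp add: hamiltonian_field_def H_p_def H_q_def sympl_rot_def p q)
qed

lemma implicit_scheme_hamiltonian:
  fixes H :: "'d::finite phase \<Rightarrow> real"
  assumes "smooth H"
  shows "implicit_scheme (hamiltonian_field H) (\<lambda>z u. sympl_rot (hessian H z u))
    (partition_weight lam) (partition_weight (1 - lam))"
proof (intro implicit_scheme.intro smooth_field.intro implicit_scheme_axioms.intro)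
  have bl: "bounded_linear (sympl_rot :: 'd phase \<Rightarrow> 'd phase)"
    using linear_sympl_rot linear_conv_bounded_linear by blast
  fix z u :: "'d phase"
  have "((\<lambda>z. sympl_rot (gradient H z)) has_derivative (\<lambda>u. sympl_rot (hessian H z u))) (at z)"
    by (rule bounded_linear.has_derivative[OF bl gradient_has_derivative[OF assms]])
  then show "(hamiltonian_field H has_derivative (\<lambda>u. sympl_rot (hessian H z u))) (at z)"
    by (simp add: hamiltonian_field_eq[OF assms, abs_def])
  show "(\<lambda>x. sympl_rot (hessian H x u)) differentiable at z"
    using differentiable_hessian[OF assms, of u z] bounded_linear.has_derivative[OF bl]
    unfolding differentiable_def by blast
  show "linear (partition_weight lam :: 'd phase \<Rightarrow> 'd phase)"
    "linear (partition_weight (1 - lam) :: 'd phase \<Rightarrow> 'd phase)"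
    by (rule linear_partition_weight)+
  show "partition_weight lam u + partition_weight (1 - lam) u = u"
    by (simp add: partition_weight_def prod_eq_iff flip: scaleR_add_left)
qed

lemma hamiltonian_step_iff:
  fixes H :: "'d::finite phase \<Rightarrow> real"
  assumes "smooth H"
  shows "implicit_scheme.step (hamiltonian_field H) (partition_weight lam) (partition_weight (1 - lam))
    = implicit_step H lam"
proof -
  interpret implicit_scheme "hamiltonian_field H" "\<lambda>z u. sympl_rot (hessian H z u)"
    "partition_weight lam" "partition_weight (1 - lam)"
    by (rule implicit_scheme_hamiltonian[OF assms])
  show ?thesis
    by (auto simp: fun_eq_iff step_def implicit_step_def partition_weight_def hamiltonian_field_def
        add.commute)
qed

lemma hamiltonian_sol_eq:
  fixes H :: "'d::finite phase \<Rightarrow> real"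
  assumes "smooth H"
  shows "implicit_scheme.sol (hamiltonian_field H) (partition_weight lam) (partition_weight (1 - lam))
    = Phi H lam"
proof -
  interpret implicit_scheme "hamiltonian_field H" "\<lambda>z u. sympl_rot (hessian H z u)"
    "partition_weight lam" "partition_weight (1 - lam)"
    by (rule implicit_scheme_hamiltonian[OF assms])
  show ?thesis
    by (simp add: fun_eq_iff sol_def Phi_def hamiltonian_step_iff[OF assms])
qed

lemma sympl_form_add_left: "sympl_form (a + b) c = sympl_form a c + sympl_form b c"
  and sympl_form_add_right: "sympl_form a (b + c) = sympl_form a b + sympl_form a c"
  and sympl_form_diff_left: "sympl_form (a - b) c = sympl_form a c - sympl_form b c"
  and sympl_form_diff_right: "sympl_form a (b - c) = sympl_form a b - sympl_form a c"
  and sympl_form_scale_left: "sympl_form (r *\<^sub>R a) c = r * sympl_form a c"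
  and sympl_form_scale_right: "sympl_form a (r *\<^sub>R c) = r * sympl_form a c"
  by (simp_all add: sympl_form_def algebra_simps inner_add_left inner_add_right
      inner_diff_left inner_diff_right)

text \<open>The form pairs only \<open>p\<close> with \<open>q\<close> components, so every term
  picks up one factor \<open>lam\<close> and one factor \<open>1 - lam\<close>; the result is
  unchanged when \<open>lam\<close> becomes \<open>1 - lam\<close>.\<close>

lemma sympl_form_partition_weight:
  "sympl_form (partition_weight lam a) (partition_weight lam b) = lam * (1 - lam) * sympl_form a b"
  by (simp add: sympl_form_def partition_weight_def algebra_simps)

text \<open>Here \<open>k\<close> and \<open>k'\<close> stand for the images of \<open>v\<close> and
  \<open>v'\<close> under the linearised field, and the hypothesis is K^T J + J K = 0 evaluated at
  these vectors.\<close>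

lemma sympl_form_stage_invariant:
  fixes v v' k k' :: "'d::finite phase"
  assumes "sympl_form k v' + sympl_form v k' = 0"
  shows "sympl_form (v + h *\<^sub>R partition_weight (1 - lam) k) (v' + h *\<^sub>R partition_weight (1 - lam) k')
    = sympl_form (v - h *\<^sub>R partition_weight lam k) (v' - h *\<^sub>R partition_weight lam k')"
proof -
  have split: "partition_weight (1 - lam) x = x - partition_weight lam x" for x :: "'d phase"
    by (simp add: partition_weight_def prod_eq_iff algebra_simps)
  have quadratic: "sympl_form (partition_weight (1 - lam) k) (partition_weight (1 - lam) k')
      = sympl_form (partition_weight lam k) (partition_weight lam k')"
    by (simp add: sympl_form_partition_weight)
  have "sympl_form (v + h *\<^sub>R partition_weight (1 - lam) k) (v' + h *\<^sub>R partition_weight (1 - lam) k')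
      - sympl_form (v - h *\<^sub>R partition_weight lam k) (v' - h *\<^sub>R partition_weight lam k')
    = h * (sympl_form (partition_weight (1 - lam) k) v' + sympl_form (partition_weight lam k) v'
        + (sympl_form v (partition_weight (1 - lam) k') + sympl_form v (partition_weight lam k')))"
    using quadratic
    by (simp add: sympl_form_add_left sympl_form_add_right sympl_form_diff_left sympl_form_diff_right
        sympl_form_scale_left sympl_form_scale_right algebra_simps)
  also have "\<dots> = h * (sympl_form k v' + sympl_form v k')"
    by (simp add: split sympl_form_diff_left sympl_form_diff_right)
  finally show ?thesis
    using assms by simp
qed

lemma sympl_form_hessian:
  assumes "smooth H"
  shows "sympl_form (sympl_rot (hessian H w u)) v + sympl_form u (sympl_rot (hessian H w v)) = 0"
  using hessian_symmetric[OF assms, of w u v]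
  by (simp add: sympl_form_def sympl_rot_def inner_prod_def)

text \<open>A matrix-free version of \<open>symplectic_at\<close>: it passes to compositions by the
  chain rule, and matrices enter only once, in
  \<open>sympl_deriv_at_imp_symplectic_at\<close>.\<close>

definition sympl_deriv_at :: "('d::finite phase \<Rightarrow> 'd phase) \<Rightarrow> 'd phase \<Rightarrow> bool" where
  "sympl_deriv_at f z \<longleftrightarrow> (\<exists>S. (f has_derivative S) (at z) \<and>
     (\<forall>u v. sympl_form (S u) (S v) = sympl_form u v))"

lemma sympl_deriv_at_compose:
  assumes "sympl_deriv_at f z" "sympl_deriv_at g (f z)"
  shows "sympl_deriv_at (g \<circ> f) z"
  using assms diff_chain_at unfolding sympl_deriv_at_def by (metis comp_apply)

lemma Phi_sympl_deriv:
  assumes "smooth H"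
  shows "\<forall>\<^sub>F (h, z) in nhds (0, z0). sympl_deriv_at (Phi H lam h) z"
proof -
  interpret implicit_scheme "hamiltonian_field H" "\<lambda>z u. sympl_rot (hessian H z u)"
    "partition_weight lam" "partition_weight (1 - lam)"
    by (rule implicit_scheme_hamiltonian[OF assms])
  have "sympl_deriv_at (sol h) z"
    if S: "(sol h has_derivative S) (at z)"
      "\<And>u. \<exists>v. u = v - h *\<^sub>R partition_weight lam (sympl_rot (hessian H w v)) \<and>
        S u = v + h *\<^sub>R partition_weight (1 - lam) (sympl_rot (hessian H w v))" for h z w S
  proof -
    have "sympl_form (S u) (S u') = sympl_form u u'" for u u'
    proof -
      obtain v v' where "u = v - h *\<^sub>R partition_weight lam (sympl_rot (hessian H w v))"
        "S u = v + h *\<^sub>R partition_weight (1 - lam) (sympl_rot (hessian H w v))"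
        "u' = v' - h *\<^sub>R partition_weight lam (sympl_rot (hessian H w v'))"
        "S u' = v' + h *\<^sub>R partition_weight (1 - lam) (sympl_rot (hessian H w v'))"
        using S(2) by metis
      with sympl_form_stage_invariant[OF sympl_form_hessian[OF assms]] show ?thesis
        by metis
    qed
    with S(1) show ?thesis by (auto simp: sympl_deriv_at_def)
  qed
  then have "\<forall>\<^sub>F (h, z) in nhds (0, z0). sympl_deriv_at (sol h) z"
    by (intro eventually_mono[OF sol_derivative[of z0]]) (clarsimp, blast)
  then show ?thesis by (simp add: hamiltonian_sol_eq[OF assms])
qed

section \<open>From invariance of the form to the matrix identity for the Jacobian\<close>

lemma stack_unstack: "stack (unstack x) = x"
  by (auto simp: stack_def unstack_def vec_eq_iff split: sum.splits)

lemma unstack_stack: "unstack (stack z) = z"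
  by (simp add: stack_def unstack_def)

lemma linear_stack: "linear stack"
  by (rule linearI) (auto simp: stack_def vec_eq_iff split: sum.splits)

lemma linear_unstack: "linear unstack"
  by (rule linearI) (auto simp: unstack_def vec_eq_iff)

lemma sum_UNIV_Plus:
  fixes g :: "'a::finite + 'b::finite \<Rightarrow> 'c::comm_monoid_add"
  shows "(\<Sum>k\<in>UNIV. g k) = (\<Sum>i\<in>UNIV. g (Inl i)) + (\<Sum>j\<in>UNIV. g (Inr j))"
  using sum.Plus[of UNIV UNIV g] by (simp add: o_def)

lemma J_mat_stack: "J_mat *v stack z = stack (snd z, - fst z)"
proof -
  have "(J_mat *v stack z) $ k = stack (snd z, - fst z) $ k" for k
    by (cases k) (simp_all add: matrix_vector_mult_def J_mat_def stack_def sum_UNIV_Plus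
        if_distrib[of "\<lambda>x. x * _"] cong: if_cong)
  then show ?thesis by (simp add: vec_eq_iff)
qed

lemma inner_stack: "stack z \<bullet> stack w = z \<bullet> w"
  by (simp add: inner_vec_def inner_prod_def stack_def sum_UNIV_Plus)

lemma inner_J_mat: "stack z \<bullet> (J_mat *v stack w) = sympl_form z w"
  by (simp add: J_mat_stack inner_stack sympl_form_def inner_prod_def)

lemma sympl_deriv_at_imp_symplectic_at:
  fixes f :: "'d::finite phase \<Rightarrow> 'd phase"
  assumes "sympl_deriv_at f z"
  shows "symplectic_at f z"
proof -
  obtain S where S: "(f has_derivative S) (at z)" "\<And>u v. sympl_form (S u) (S v) = sympl_form u v"
    using assms unfolding sympl_deriv_at_def by blast
  define F where "F = stack \<circ> f \<circ> unstack"
  define M where "M = jacobian F (at (stack z))"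
  have F: "(F has_derivative stack \<circ> S \<circ> unstack) (at (stack z))"
    unfolding F_def
    by (intro diff_chain_at linear_imp_has_derivative linear_stack linear_unstack)
      (simp add: unstack_stack S(1))
  then have "F differentiable at (stack z)"
    by (rule differentiableI)
  then have "(F has_derivative (*v) M) (at (stack z))"
    unfolding M_def using jacobian_works by blast
  then have M: "M *v x = stack (S (unstack x))" for x
    using has_derivative_unique[OF _ F] by (metis comp_apply)
  have "x \<bullet> ((transpose M ** J_mat ** M) *v y) = x \<bullet> (J_mat *v y)" for x y
  proof -
    have "x \<bullet> (transpose M *v w) = (M *v x) \<bullet> w" for w
      by (metis dot_lmul_matrix vector_transpose_matrix)
    then have "x \<bullet> ((transpose M ** J_mat ** M) *v y) = (M *v x) \<bullet> (J_mat *v (M *v y))"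
      by (simp flip: matrix_vector_mul_assoc)
    also have "\<dots> = sympl_form (unstack x) (unstack y)"
      by (simp add: M inner_J_mat S(2))
    also have "\<dots> = x \<bullet> (J_mat *v y)"
      by (simp flip: inner_J_mat add: stack_unstack)
    finally show ?thesis .
  qed
  then have "transpose M ** J_mat ** M = J_mat"
    unfolding matrix_eq using vector_eq_ldot by metis
  moreover have "f differentiable at z"
    using S(1) by (rule differentiableI)
  ultimately show ?thesis
    by (simp add: symplectic_at_def Let_def M_def F_def)
qed

section \<open>Second order\<close>

text \<open>O(h^n) for vector-valued errors and steps of either sign; it is converted to the Landau
  symbol of the norm in \<open>symmetric_composition_order_2\<close>.\<close>

definition step_O :: "nat \<Rightarrow> (real \<Rightarrow> 'a::real_normed_vector) \<Rightarrow> bool" where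
  "step_O n e \<longleftrightarrow> (\<exists>C. \<forall>\<^sub>F h in at 0. norm (e h) \<le> C * \<bar>h\<bar> ^ n)"

lemma step_O_bound:
  assumes "step_O n e"
  obtains C where "0 < C" "\<forall>\<^sub>F h in at 0. norm (e h) \<le> C * \<bar>h\<bar> ^ n"
proof -
  obtain C where C: "\<forall>\<^sub>F h in at 0. norm (e h) \<le> C * \<bar>h\<bar> ^ n"
    using assms unfolding step_O_def by blast
  then have "\<forall>\<^sub>F h in at 0. norm (e h) \<le> (\<bar>C\<bar> + 1) * \<bar>h\<bar> ^ n"
  proof eventually_elim
    case (elim h)
    also have "C * \<bar>h\<bar> ^ n \<le> (\<bar>C\<bar> + 1) * \<bar>h\<bar> ^ n"
      by (intro mult_right_mono) auto
    finally show ?case .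
  qed
  then show thesis by (intro that[of "\<bar>C\<bar> + 1"]) auto
qed

lemma step_O_add:
  assumes "step_O n e" "step_O n f"
  shows "step_O n (\<lambda>h. e h + f h)"
proof -
  obtain C D where "\<forall>\<^sub>F h in at 0. norm (e h) \<le> C * \<bar>h\<bar> ^ n" "\<forall>\<^sub>F h in at 0. norm (f h) \<le> D * \<bar>h\<bar> ^ n"
    using assms unfolding step_O_def by blast
  then have "\<forall>\<^sub>F h in at 0. norm (e h + f h) \<le> (C + D) * \<bar>h\<bar> ^ n"
  proof eventually_elim
    case (elim h)
    then show ?case
      using norm_triangle_ineq[of "e h" "f h"] by (simp add: distrib_right)
  qed
  then show ?thesis unfolding step_O_def by blast
qed

lemma step_O_linear:
  fixes T :: "'a::euclidean_space \<Rightarrow> 'b::real_normed_vector"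
  assumes "step_O n e" "linear T"
  shows "step_O n (\<lambda>h. T (e h))"
proof -
  obtain C where C: "\<forall>\<^sub>F h in at 0. norm (e h) \<le> C * \<bar>h\<bar> ^ n"
    using assms(1) unfolding step_O_def by blast
  obtain K where K: "0 < K" "\<And>u. norm (T u) \<le> norm u * K"
    using assms(2) bounded_linear.pos_bounded linear_conv_bounded_linear by blast
  from C have "\<forall>\<^sub>F h in at 0. norm (T (e h)) \<le> (C * K) * \<bar>h\<bar> ^ n"
  proof eventually_elim
    case (elim h)
    have "norm (T (e h)) \<le> norm (e h) * K" by (rule K)
    also have "\<dots> \<le> C * \<bar>h\<bar> ^ n * K" using elim K(1) by (intro mult_right_mono) auto
    finally show ?case by (simp add: mult_ac)
  qed
  then show ?thesis unfolding step_O_def by blast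
qed

lemma step_O_uminus: "step_O n e \<Longrightarrow> step_O n (\<lambda>h. - e h)"
  by (simp add: step_O_def)

lemma step_O_diff: "step_O n e \<Longrightarrow> step_O n f \<Longrightarrow> step_O n (\<lambda>h. e h - f h)"
  using step_O_add[of n e "\<lambda>h. - f h"] step_O_uminus[of n f] by simp

lemma step_O_scaleR:
  assumes "step_O n e"
  shows "step_O (Suc n) (\<lambda>h. h *\<^sub>R e h)"
proof -
  obtain C where "\<forall>\<^sub>F h in at 0. norm (e h) \<le> C * \<bar>h\<bar> ^ n"
    using assms unfolding step_O_def by blast
  then have "\<forall>\<^sub>F h in at 0. norm (h *\<^sub>R e h) \<le> C * \<bar>h\<bar> ^ Suc n"
  proof eventually_elim
    case (elim h)
    then show ?case
      using mult_left_mono[OF elim, of "\<bar>h\<bar>"] by (simp add: mult_ac)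
  qed
  then show ?thesis unfolding step_O_def by blast
qed

lemma step_O_transform:
  assumes "step_O n e" "\<forall>\<^sub>F h in at 0. e h = f h"
  shows "step_O n f"
proof -
  obtain C where "\<forall>\<^sub>F h in at 0. norm (e h) \<le> C * \<bar>h\<bar> ^ n"
    using assms(1) unfolding step_O_def by blast
  with assms(2) have "\<forall>\<^sub>F h in at 0. norm (f h) \<le> C * \<bar>h\<bar> ^ n"
    by eventually_elim simp
  then show ?thesis unfolding step_O_def by blast
qed

lemma step_O_const: "step_O 0 (\<lambda>h. c)"
  unfolding step_O_def by (intro exI[of _ "norm c"]) simp

lemma step_O_linear_term: "step_O 1 (\<lambda>h. h *\<^sub>R c)"
  using step_O_scaleR[OF step_O_const, of c] by simp

lemma eventually_at_0_abs_less:
  assumes "0 < (d :: real)"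
  shows "\<forall>\<^sub>F h :: real in at 0. \<bar>h\<bar> < d"
  using assms unfolding eventually_at by (intro exI[of _ d]) (auto simp: dist_norm)

lemma step_O_Suc_imp:
  assumes "step_O (Suc n) e"
  shows "step_O n e"
proof -
  obtain C where C: "0 < C" "\<forall>\<^sub>F h in at 0. norm (e h) \<le> C * \<bar>h\<bar> ^ Suc n"
    using assms by (rule step_O_bound)
  from C(2) eventually_at_0_abs_less[OF zero_less_one]
  have "\<forall>\<^sub>F h in at 0. norm (e h) \<le> C * \<bar>h\<bar> ^ n"
  proof eventually_elim
    case (elim h)
    have "C * \<bar>h\<bar> ^ Suc n \<le> C * \<bar>h\<bar> ^ n"
      using C(1) elim(2) by (intro mult_left_mono power_decreasing) auto
    with elim(1) show ?case by linarith
  qed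
  then show ?thesis unfolding step_O_def by blast
qed

lemma step_O_2_imp_1: "step_O 2 e \<Longrightarrow> step_O 1 e"
  using step_O_Suc_imp[of 1 e] by (simp add: numeral_2_eq_2)

lemma step_O_imp_tendsto:
  assumes "step_O (Suc 0) (\<lambda>h. w h - z)"
  shows "(w \<longlongrightarrow> z) (at 0)"
proof -
  obtain C where "\<forall>\<^sub>F h in at 0. norm (w h - z) \<le> C * \<bar>h\<bar>"
    using assms unfolding step_O_def by auto
  moreover have "((\<lambda>h. C * \<bar>h\<bar>) \<longlongrightarrow> 0) (at 0)"
    by (auto intro!: tendsto_eq_intros)
  ultimately have "((\<lambda>h. w h - z) \<longlongrightarrow> 0) (at 0)"
    by (rule Lim_null_comparison)
  then show ?thesis by (simp add: LIM_zero_iff)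
qed

lemma step_O_half:
  assumes "step_O n e"
  shows "step_O n (\<lambda>h. e (h / 2))"
proof -
  obtain C where "\<forall>\<^sub>F h in at 0. norm (e h) \<le> C * \<bar>h\<bar> ^ n"
    using assms unfolding step_O_def by blast
  then obtain d where d: "0 < d" "\<And>h. h \<noteq> 0 \<Longrightarrow> \<bar>h\<bar> < d \<Longrightarrow> norm (e h) \<le> C * \<bar>h\<bar> ^ n"
    unfolding eventually_at by (auto simp: dist_norm)
  have "\<forall>\<^sub>F h in at 0. norm (e (h / 2)) \<le> C / 2 ^ n * \<bar>h\<bar> ^ n"
    unfolding eventually_at
  proof (intro exI[of _ d] conjI ballI impI)
    fix h :: real assume h: "h \<noteq> 0 \<and> dist h 0 < d"
    then have "norm (e (h / 2)) \<le> C * \<bar>h / 2\<bar> ^ n"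
      by (intro d(2)) (auto simp: dist_norm)
    then show "norm (e (h / 2)) \<le> C / 2 ^ n * \<bar>h\<bar> ^ n"
      by (simp add: power_divide)
  qed (rule d)
  then show ?thesis unfolding step_O_def by blast
qed

text \<open>The mean value inequality on the segment from 0 to \<open>h\<close> gains one power.
  \<open>step_O\<close> says nothing about \<open>h = 0\<close>, which lies on that segment, so the
  value of \<open>g'\<close> there is prescribed.\<close>

lemma step_O_integrate:
  fixes g :: "real \<Rightarrow> 'a::euclidean_space"
  assumes "0 < T" and deriv: "\<And>t. \<bar>t\<bar> < T \<Longrightarrow> (g has_vector_derivative g' t) (at t)"
    and "g 0 = 0" "g' 0 = 0" "step_O n g'"
  shows "step_O (Suc n) g"
proof -
  obtain C where C: "0 < C" "\<forall>\<^sub>F h in at 0. norm (g' h) \<le> C * \<bar>h\<bar> ^ n"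
    using assms(5) by (rule step_O_bound)
  then obtain d where d: "0 < d" "\<And>h. h \<noteq> 0 \<Longrightarrow> \<bar>h\<bar> < d \<Longrightarrow> norm (g' h) \<le> C * \<bar>h\<bar> ^ n"
    unfolding eventually_at by (auto simp: dist_norm)
  have bound: "norm (g' h) \<le> C * \<bar>h\<bar> ^ n" if "\<bar>h\<bar> < d" for h
    using that d(2)[of h] C(1) \<open>g' 0 = 0\<close> by (cases "h = 0") auto
  have "norm (g h) \<le> C * \<bar>h\<bar> ^ Suc n" if h: "\<bar>h\<bar> < min d T" for h
  proof -
    have seg: "\<bar>t\<bar> \<le> \<bar>h\<bar>" if "t \<in> closed_segment 0 h" for t
      using that by (auto simp: closed_segment_eq_real_ivl split: if_splits)
    have "norm (g h - g 0) \<le> (C * \<bar>h\<bar> ^ n) * norm (h - 0)"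
    proof (rule differentiable_bound[of "closed_segment 0 h" g "\<lambda>t x. x *\<^sub>R g' t"])
      fix t assume t: "t \<in> closed_segment 0 h"
      show "(g has_derivative (\<lambda>x. x *\<^sub>R g' t)) (at t within closed_segment 0 h)"
        using deriv[of t] seg[OF t] h
        by (auto simp: has_vector_derivative_def intro: has_derivative_at_withinI)
      have "norm (g' t) \<le> C * \<bar>t\<bar> ^ n"
        using seg[OF t] h by (intro bound) auto
      also have "\<dots> \<le> C * \<bar>h\<bar> ^ n"
        using C(1) seg[OF t] by (intro mult_left_mono power_mono) auto
      finally show "onorm (\<lambda>x. x *\<^sub>R g' t) \<le> C * \<bar>h\<bar> ^ n"
        by (intro onorm_le) (simp add: mult.commute[of _ "norm _"] mult_right_mono)
    qed auto
    then show ?thesis using \<open>g 0 = 0\<close> by (simp add: mult_ac)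
  qed
  moreover have "\<forall>\<^sub>F h in at 0. \<bar>h\<bar> < min d T"
    using d(1) assms(1) by (intro eventually_at_0_abs_less) auto
  ultimately have "\<forall>\<^sub>F h in at 0. norm (g h) \<le> C * \<bar>h\<bar> ^ Suc n"
    by (auto elim: eventually_mono)
  then show ?thesis unfolding step_O_def by blast
qed

section \<open>Expansions of the exact flow and of the scheme\<close>

context smooth_field
begin

lemma step_O_X_remainder:
  assumes "step_O 1 (\<lambda>h. w h - z0)"
  shows "step_O 2 (\<lambda>h. X (w h) - X z0 - X' z0 (w h - z0))"
proof -
  obtain K where K: "0 < K" "\<forall>\<^sub>F h in at 0. norm (w h - z0) \<le> K * \<bar>h\<bar> ^ 1"
    using assms by (rule step_O_bound)
  obtain C where C: "0 < C"
    "\<forall>\<^sub>F w in nhds z0. norm (X w - X z0 - X' z0 (w - z0)) \<le> C * norm (w - z0) ^ 2"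
    by (rule X_quadratic_remainder)
  have "(w \<longlongrightarrow> z0) (at 0)"
    using assms by (intro step_O_imp_tendsto) simp
  from filterlim_iff[THEN iffD1, OF this, rule_format, OF C(2)] K(2)
  have "\<forall>\<^sub>F h in at 0. norm (X (w h) - X z0 - X' z0 (w h - z0)) \<le> (C * K ^ 2) * \<bar>h\<bar> ^ 2"
  proof eventually_elim
    case (elim h)
    note elim(1)
    also have "C * norm (w h - z0) ^ 2 \<le> C * (K * \<bar>h\<bar> ^ 1) ^ 2"
      using elim(2) C(1) by (intro mult_left_mono power_mono) auto
    finally show ?case by (simp add: power_mult_distrib mult.assoc)
  qed
  then show ?thesis unfolding step_O_def by blast
qed

lemma step_O_X_diff:
  assumes "step_O 1 (\<lambda>h. w h - z0)"
  shows "step_O 1 (\<lambda>h. X (w h) - X z0)"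
proof -
  have "step_O 1 (\<lambda>h. X (w h) - X z0 - X' z0 (w h - z0))"
    using step_O_X_remainder[OF assms] by (rule step_O_2_imp_1)
  from step_O_add[OF this step_O_linear[OF assms linear_X'[of z0]]] show ?thesis
    by simp
qed

lemma step_O_X_expand:
  assumes "step_O 2 (\<lambda>h. w h - z0 - h *\<^sub>R a)"
  shows "step_O 2 (\<lambda>h. X (w h) - X z0 - h *\<^sub>R X' z0 a)"
proof -
  have "step_O 1 (\<lambda>h. w h - z0 - h *\<^sub>R a)"
    using assms by (rule step_O_2_imp_1)
  from step_O_add[OF this step_O_linear_term[of a]] have "step_O 1 (\<lambda>h. w h - z0)"
    by simp
  from step_O_add[OF step_O_X_remainder[OF this] step_O_linear[OF assms linear_X', of z0]]
  show ?thesis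
    by (simp add: linear_diff[OF linear_X'] linear_cmul[OF linear_X'])
qed

text \<open>A bootstrap: continuity of \<open>y\<close> bounds the derivative of \<open>?g\<close>
  by 1, integration gives O(h), and feeding each bound back through \<open>X\<close> and integrating
  again gives O(h^2) and then O(h^3).\<close>

lemma flow_expansion:
  assumes "0 < T" and "y 0 = z0"
    and y: "\<And>t. \<bar>t\<bar> < T \<Longrightarrow> (y has_vector_derivative X (y t)) (at t)"
  shows "step_O 3 (\<lambda>h. y h - z0 - h *\<^sub>R X z0 - (h ^ 2 / 2) *\<^sub>R X' z0 (X z0))"
proof -
  let ?g = "\<lambda>h. y h - z0 - h *\<^sub>R X z0"
  have g: "(?g has_vector_derivative X (y t) - X z0) (at t)" if "\<bar>t\<bar> < T" for t
    using y[OF that] by (auto intro!: derivative_eq_intros)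
  have "isCont y 0"
    using y[of 0] assms(1) by (auto intro: has_vector_derivative_continuous)
  from isCont_o2[OF this has_derivative_continuous[OF X_deriv]]
  have "isCont (\<lambda>h. X (y h)) 0" .
  then have "((\<lambda>h. norm (X (y h) - X z0)) \<longlongrightarrow> 0) (at 0)"
    using assms(2) by (simp add: isCont_def tendsto_norm_zero LIM_zero)
  then have "\<forall>\<^sub>F h in at 0. norm (X (y h) - X z0) < 1"
    by (rule order_tendstoD) simp
  then have "step_O 0 (\<lambda>h. X (y h) - X z0)"
    unfolding step_O_def by (intro exI[of _ 1]) (auto elim: eventually_mono)
  from step_O_integrate[OF assms(1) g _ _ this] have "step_O 1 ?g"
    using assms(2) by simp
  from step_O_add[OF this step_O_linear_term[of "X z0"]] have "step_O 1 (\<lambda>h. y h - z0)"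
    by simp
  from step_O_integrate[OF assms(1) g _ _ step_O_X_diff[OF this]] have "step_O 2 ?g"
    using assms(2) by (simp add: numeral_2_eq_2)
  then have O2: "step_O 2 (\<lambda>h. X (y h) - X z0 - h *\<^sub>R X' z0 (X z0))"
    by (rule step_O_X_expand)
  have "((\<lambda>h. ?g h - (h ^ 2 / 2) *\<^sub>R X' z0 (X z0)) has_vector_derivative
      X (y t) - X z0 - t *\<^sub>R X' z0 (X z0)) (at t)" if "\<bar>t\<bar> < T" for t
    using y[OF that] by (auto intro!: derivative_eq_intros)
  from step_O_integrate[OF assms(1) this _ _ O2] show ?thesis
    using assms(2) by (simp add: numeral_3_eq_3 numeral_2_eq_2)
qed

end

context implicit_scheme
begin

text \<open>The starting point \<open>b h\<close> moves with \<open>h\<close> because the second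
  half step begins where the first one ends. The first conclusion, with \<open>a = 0\<close> for the
  first half step, supplies the hypothesis for the second.\<close>

lemma sol_expansion:
  assumes "step_O 2 (\<lambda>h. b h - z0 - h *\<^sub>R a)"
  shows "step_O 2 (\<lambda>h. sol h (b h) - z0 - h *\<^sub>R (a + X z0))"
    and "step_O 3 (\<lambda>h. sol h (b h) - b h - h *\<^sub>R X z0 - h ^ 2 *\<^sub>R X' z0 (a + D (X z0)))"
proof -
  obtain s \<eta> M where *: "0 < s" "0 < \<eta>" "0 < M" and near: "solves_near z0 s \<eta> M"
    by (rule local_solution)
  have "step_O 1 (\<lambda>h. b h - z0 - h *\<^sub>R a)"
    using assms by (rule step_O_2_imp_1)
  from step_O_add[OF this step_O_linear_term[of a]] have b1: "step_O 1 (\<lambda>h. b h - z0)"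
    by simp
  then have "(b \<longlongrightarrow> z0) (at 0)"
    by (intro step_O_imp_tendsto) simp
  then have "\<forall>\<^sub>F h in at 0. dist (b h) z0 < \<eta>"
    using *(2) by (rule tendstoD)
  with eventually_at_0_abs_less[OF *(2)]
  have ev: "\<forall>\<^sub>F h in at 0. sol h (b h) = b h + h *\<^sub>R X (D (sol h (b h)) + E (b h)) \<and>
      dist (sol h (b h)) (b h) \<le> M * \<bar>h\<bar>"
    by eventually_elim (use solves_nearD(1-3)[OF near] step_def in metis)
  let ?w = "\<lambda>h. D (sol h (b h)) + E (b h)"
  have "\<forall>\<^sub>F h in at 0. norm (sol h (b h) - b h) \<le> M * \<bar>h\<bar> ^ 1"
    using ev by eventually_elim (simp add: dist_norm)
  then have s1: "step_O 1 (\<lambda>h. sol h (b h) - b h)"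
    unfolding step_O_def by blast
  \<comment> \<open>Replacing \<open>E\<close> by the identity minus \<open>D\<close> expresses the
    stage value through displacement and starting point, so each better bound on the displacement
    improves the stage value.\<close>
  have w_eq: "?w h - z0 = D (sol h (b h) - b h) + (b h - z0)" for h
    using D_plus_E[of "b h"] by (simp add: linear_diff[OF linear_D] algebra_simps)
  have "step_O 1 (\<lambda>h. ?w h - z0)"
    unfolding w_eq by (intro step_O_add step_O_linear[OF s1 linear_D] b1)
  from step_O_scaleR[OF step_O_X_diff[OF this]]
  have "step_O 2 (\<lambda>h. h *\<^sub>R (X (?w h) - X z0))"
    by (simp add: numeral_2_eq_2)
  moreover have "\<forall>\<^sub>F h in at 0. h *\<^sub>R (X (?w h) - X z0) = sol h (b h) - b h - h *\<^sub>R X z0"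
    using ev by eventually_elim (metis add_diff_cancel_left' scaleR_diff_right)
  ultimately have s2: "step_O 2 (\<lambda>h. sol h (b h) - b h - h *\<^sub>R X z0)"
    by (rule step_O_transform)
  show "step_O 2 (\<lambda>h. sol h (b h) - z0 - h *\<^sub>R (a + X z0))"
    using step_O_add[OF s2 assms] by (simp add: algebra_simps)
  \<comment> \<open>The displacement is now known up to O(h^2), which fixes the first-order
    coefficient of the stage value; the factor \<open>h\<close> in front of \<open>X\<close>
    supplies the last power.\<close>
  have "step_O 2 (\<lambda>h. ?w h - z0 - h *\<^sub>R (a + D (X z0)))"
    using step_O_add[OF step_O_linear[OF s2 linear_D] assms] unfolding w_eq
    by (simp add: linear_add[OF linear_D] linear_diff[OF linear_D] linear_cmul[OF linear_D] algebra_simps)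
  from step_O_scaleR[OF step_O_X_expand[OF this]]
  have "step_O 3 (\<lambda>h. h *\<^sub>R (X (?w h) - X z0 - h *\<^sub>R X' z0 (a + D (X z0))))"
    by (simp add: numeral_3_eq_3 numeral_2_eq_2)
  moreover have "\<forall>\<^sub>F h in at 0. h *\<^sub>R (X (?w h) - X z0 - h *\<^sub>R X' z0 (a + D (X z0)))
      = sol h (b h) - b h - h *\<^sub>R X z0 - h ^ 2 *\<^sub>R X' z0 (a + D (X z0))"
    using ev
  proof eventually_elim
    case (elim h)
    then have "h *\<^sub>R X (?w h) = sol h (b h) - b h" by (metis add_diff_cancel_left')
    then show ?case by (simp add: scaleR_diff_right power2_eq_square)
  qed
  ultimately show "step_O 3 (\<lambda>h. sol h (b h) - b h - h *\<^sub>R X z0 - h ^ 2 *\<^sub>R X' z0 (a + D (X z0)))"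
    by (rule step_O_transform)
qed

end

context implicit_scheme
begin

text \<open>For half steps of size k the second-order terms are k^2 \<open>X'\<close> applied to
  \<open>E (X z0)\<close> and to \<open>X z0 + D (X z0)\<close>, where the extra \<open>X z0\<close>
  is the shift of the second starting point. As \<open>D\<close> and \<open>E\<close> add up to the
  identity, \<open>lam\<close> cancels and 2 k^2 \<open>X' z0 (X z0)\<close> remains.\<close>

lemma symmetric_composition_expansion:
  "step_O 3 (\<lambda>h. sol (h / 2) (adj.sol (h / 2) z0)
     - z0 - h *\<^sub>R X z0 - (h ^ 2 / 2) *\<^sub>R X' z0 (X z0))"
proof -
  have "step_O 2 (\<lambda>h. z0 - z0 - h *\<^sub>R 0)"
    by (simp add: step_O_def exI[of _ 0])
  note adj = adj.sol_expansion[OF this]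
  have "step_O 2 (\<lambda>h. adj.sol h z0 - z0 - h *\<^sub>R X z0)"
    using adj(1) by simp
  from step_O_add[OF sol_expansion(2)[OF this] adj(2)]
  have "step_O 3 (\<lambda>h. sol h (adj.sol h z0) - adj.sol h z0 - h *\<^sub>R X z0
      - h ^ 2 *\<^sub>R X' z0 (X z0 + D (X z0))
      + (adj.sol h z0 - z0 - h *\<^sub>R X z0 - h ^ 2 *\<^sub>R X' z0 (0 + E (X z0))))" .
  moreover have "X' z0 (X z0 + D (X z0)) + X' z0 (E (X z0)) = 2 *\<^sub>R X' z0 (X z0)"
    using D_plus_E[of "X z0"] linear_add[OF linear_X']
    by (metis add.assoc scaleR_2)
  then have "h ^ 2 *\<^sub>R X' z0 (X z0 + D (X z0)) + h ^ 2 *\<^sub>R X' z0 (E (X z0))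
      = (2 * h ^ 2) *\<^sub>R X' z0 (X z0)" for h
    by (metis mult.commute scaleR_right_distrib scaleR_scaleR)
  then have "sol h (adj.sol h z0) - adj.sol h z0 - h *\<^sub>R X z0
      - h ^ 2 *\<^sub>R X' z0 (X z0 + D (X z0))
      + (adj.sol h z0 - z0 - h *\<^sub>R X z0 - h ^ 2 *\<^sub>R X' z0 (0 + E (X z0)))
    = sol h (adj.sol h z0) - z0 - (2 * h) *\<^sub>R X z0 - (2 * h ^ 2) *\<^sub>R X' z0 (X z0)" for h
    by (simp add: algebra_simps scaleR_2[symmetric])
  ultimately have "step_O 3 (\<lambda>h. sol h (adj.sol h z0) - z0 - (2 * h) *\<^sub>R X z0
      - (2 * h ^ 2) *\<^sub>R X' z0 (X z0))"
    by (simp only:)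
  \<comment> \<open>Halving the step turns \<open>2 * h\<close> into \<open>h\<close> and
    \<open>2 * h ^ 2\<close> into \<open>h ^ 2 / 2\<close>.\<close>
  from step_O_half[OF this] show ?thesis
    by (simp add: power_divide)
qed

lemma symmetric_composition_order_2:
  "method_of_order 2 (\<lambda>h. sol (h / 2) \<circ> adj.sol (h / 2)) X"
  unfolding method_of_order_def
proof (intro allI impI)
  fix z0 y T
  assume "0 < T" "y 0 = z0" "\<forall>t\<in>{-T<..<T}. (y has_vector_derivative X (y t)) (at t)"
  then have "step_O 3 (\<lambda>h. y h - z0 - h *\<^sub>R X z0 - (h ^ 2 / 2) *\<^sub>R X' z0 (X z0))"
    by (intro flow_expansion) (auto simp: abs_less_iff)
  from step_O_diff[OF symmetric_composition_expansion[where ?z0.0 = z0] this]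
  have "step_O 3 (\<lambda>h. (sol (h / 2) \<circ> adj.sol (h / 2)) z0 - y h)"
    by simp
  then obtain C where "\<forall>\<^sub>F h in at 0. norm ((sol (h / 2) \<circ> adj.sol (h / 2)) z0 - y h) \<le> C * \<bar>h\<bar> ^ 3"
    unfolding step_O_def by blast
  then show "(\<lambda>h. norm ((sol (h / 2) \<circ> adj.sol (h / 2)) z0 - y h)) \<in> O[at 0](\<lambda>h. h ^ (2 + 1))"
    by (intro bigoI[of _ C]) (auto simp: power_abs)
qed

end

text \<open>Being an adjoint constrains a method only near \<open>h = 0\<close>, so the identity of
  the adjoint is expressed by two facts: \<open>Phi H (1 - lam)\<close> is an adjoint, and every
  adjoint agrees with it locally.\<close>

theorem mainTheorem6:
  fixes H :: "(real ^ 'd::finite) \<times> (real ^ 'd) \<Rightarrow> real" and lam :: real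
  assumes "smooth H"
  shows "locally_defined_by (Phi H lam) (implicit_step H lam) \<and>
    is_adjoint (Phi H lam) (Phi H (1 - lam)) \<and>
    (\<forall>A. is_adjoint (Phi H lam) A \<longrightarrow>
       locally_equal A (Phi H (1 - lam)) \<and>
       locally_equal (\<lambda>h. Phi H lam (h / 2) \<circ> A (h / 2)) (Psi H lam)) \<and>
    symmetric_method (Psi H lam) \<and>
    symplectic_method (Psi H lam) \<and>
    method_of_order 2 (Psi H lam) (hamiltonian_field H)"
proof -
  interpret implicit_scheme "hamiltonian_field H" "\<lambda>z u. sympl_rot (hessian H z u)"
    "partition_weight lam" "partition_weight (1 - lam)"
    by (rule implicit_scheme_hamiltonian[OF assms])
  have sol: "sol = Phi H lam" and step: "step = implicit_step H lam"
    by (simp_all add: hamiltonian_sol_eq[OF assms] hamiltonian_step_iff[OF assms])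
  have adj_sol: "adj.sol = Phi H (1 - lam)"
    using hamiltonian_sol_eq[OF assms, of "1 - lam"] by simp
  have Psi: "Psi H lam = (\<lambda>h. sol (h / 2) \<circ> adj.sol (h / 2))"
    by (simp add: fun_eq_iff Psi_def sol adj_sol)
  note inverse = locally_inverts_adj_sol adj.locally_inverts_adj_sol
  have near_Psi: "near_identity (Psi H lam)"
    using near_identity_compose[OF near_identity_sol adj.near_identity_sol, of "1 / 2" "1 / 2"]
    by (simp add: Psi)
  have inverse_Psi: "locally_inverts (Psi H lam) (Psi H lam)"
    unfolding Psi
    by (rule locally_inverts_symmetric_composition[OF near_identity_sol adj.near_identity_sol inverse])
  have adjoint_eq: "locally_equal A (Phi H (1 - lam)) \<and>
      locally_equal (\<lambda>h. Phi H lam (h / 2) \<circ> A (h / 2)) (Psi H lam)"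
    if "is_adjoint (Phi H lam) A" for A
  proof
    show eq: "locally_equal A (Phi H (1 - lam))"
      using adjoint_locally_unique[of sol A adj.sol] that adj.near_identity_sol inverse(2)
      by (simp add: sol adj_sol)
    have "\<forall>\<^sub>F (h, z) in nhds (0, z0). (Phi H lam (h / 2) \<circ> A (h / 2)) z = Psi H lam h z" for z0
      using eventually_scale_step[OF eq[unfolded locally_equal_def, rule_format], of "1 / 2" z0]
      by eventually_elim (auto simp: Psi_def)
    then show "locally_equal (\<lambda>h. Phi H lam (h / 2) \<circ> A (h / 2)) (Psi H lam)"
      unfolding locally_equal_def by blast
  qed
  have "\<forall>\<^sub>F (h, z) in nhds (0, z0). symplectic_at (Psi H lam h) z" for z0
  proof -
    \<comment> \<open>The outer half step is differentiated at the image of the inner one, which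
      still tends to \<open>z0\<close>.\<close>
    have "\<forall>\<^sub>F (h, z) in nhds (0, z0). sympl_deriv_at (Phi H lam (1 / 2 * h)) (adj.sol (1 / 2 * h) z)"
      by (rule eventually_after_step[OF adj.near_identity_sol Phi_sympl_deriv[OF assms]])
    moreover have "\<forall>\<^sub>F (h, z) in nhds (0, z0). sympl_deriv_at (Phi H (1 - lam) (1 / 2 * h)) z"
      by (rule eventually_scale_step[OF Phi_sympl_deriv[OF assms]])
    ultimately show ?thesis
      by eventually_elim
        (auto simp: Psi_def adj_sol intro!: sympl_deriv_at_imp_symplectic_at sympl_deriv_at_compose)
  qed
  moreover have "is_adjoint (Phi H lam) (Phi H (1 - lam))"
    using is_adjointI[OF adj.near_identity_sol inverse] by (simp add: sol adj_sol)
  moreover have "method_of_order 2 (Psi H lam) (hamiltonian_field H)"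
    unfolding Psi by (rule symmetric_composition_order_2)
  ultimately show ?thesis
    using locally_defined_sol adjoint_eq is_adjointI[OF near_Psi inverse_Psi inverse_Psi]
    by (simp add: sol step symmetric_method_def symplectic_method_def)
qed

end
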